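(* Let $\mathcal{P}$ be a thin cycle polyomino all of whose maximal inner intervals have length at least $3$. Then $I_{\mathcal{P}}$ is a prime ideal.
   Context: **Polyominoes.** For $a=(i,j),b=(k,\ell)\in\mathbb{N}^2$ with $i\le k$, $j\le \ell$, the interval $[a,b]$ is $\{(r,s)\in\mathbb{N}^2: i\le r\le k,\ j\le s\le \ell\}$. It is proper if $i<k$ and $j<\ell$; then $a$ and $b$ are its diagonal corners, and $c=(i,\ell)$ and $d=(k,j)$ are its anti-diagonal corners. A cell is an interval $C=[a,a+(1,1)]$; its vertex set $V(C)$ consists of its four corners, and its edges are $\{a,a+(1,0)\}$, $\{a,a+(0,1)\}$, $\{a+(1,0),a+(1,1)\}$, $\{a+(0,1),a+(1,1)\}$. A polyomino is a finite collection $\mathcal{P}$ of cells such that any two cells $C,D$ of $\mathcal{P}$ are connected by a sequence of cells $C=C_1,\dots,C_m=D$ of $\mathcal{P}$ with $C_t\cap C_{t+1}$ an edge of $C_t$ for every $t<m$; such a sequence is a path if its cells are pairwise distinct. Put $V(\mathcal{P})=\bigcup_{C\in\mathcal{P}}V(C)$. A proper interval $[a,b]$ is an inner interval of $\mathcal{P}$ if all cells contained in $[a,b]$ belong to $\mathcal{P}$; it is maximal if it is not strictly contained in another inner interval. A polyomino is thin if it contains no four cells forming a $2\times2$ square; every inner interval of a thin polyomino is then a row or column of cells, and its length is its number of cells. **Thin cycle.** A thin polyomino $\mathcal{P}=\{C_1,\dots,C_n\}$ is a thin cycle if its cells can be relabelled so that $C_1,C_2,\dots,C_n$ is a path of cells,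 $C_1$ and $C_n$ have an edge in common, and $C_i\cap C_j=\emptyset$ whenever the cyclic distance $\min(|i-j|,\,n-|i-j|)$ is greater than $2$. **Polyomino ideal.** Let $\mathbb{K}$ be a field and $S=\mathbb{K}[x_v\mid v\in V(\mathcal{P})]$. $I_{\mathcal{P}}\subset S$ is the ideal generated by all inner 2-minors $x_ax_b-x_cx_d$, where $[a,b]$ ranges over the inner intervals of $\mathcal{P}$ and $c,d$ are the anti-diagonal corners of $[a,b]$. *)

theory Defs
  imports
    "HOL-Library.Product_Plus"
    "HOL-Library.Product_Order"
    "HOL-Library.Poly_Mapping"
    "HOL-Algebra.Ideal"
begin

section \<open>Polyominoes\<close>

text \<open>
  The order on \<^typ>\<open>nat \<times> nat\<close> is the componentwise one, so \<open>{a..b}\<close> is the interval \<open>[a, b]\<close> of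
  lattice points. Cells and edges are sets of lattice points; in particular a cell is equal to its
  own vertex set.
\<close>

type_synonym point = "nat \<times> nat"

definition cell :: "point \<Rightarrow> point set" where
  "cell a = {a..a + (1, 1)}"

definition cell_edges :: "point \<Rightarrow> point set set" where
  "cell_edges a =
     {{a, a + (1, 0)}, {a, a + (0, 1)}, {a + (1, 0), a + (1, 1)}, {a + (0, 1), a + (1, 1)}}"

text \<open>The lower left corner of a cell is determined by the cell.\<close>

definition edges :: "point set \<Rightarrow> point set set" where
  "edges C = {e. \<exists>a. C = cell a \<and> e \<in> cell_edges a}"

definition cell_walk :: "point set set \<Rightarrow> point set list \<Rightarrow> bool" where
  "cell_walk P Cs \<longleftrightarrow> Cs \<noteq> [] \<and> set Cs \<subseteq> P \<and>
     (\<forall>t. Suc t < length Cs \<longrightarrow> Cs ! t \<inter> Cs ! Suc t \<in> edges (Cs ! t))"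

definition cell_path :: "point set set \<Rightarrow> point set list \<Rightarrow> bool" where
  "cell_path P Cs \<longleftrightarrow> cell_walk P Cs \<and> distinct Cs"

definition polyomino :: "point set set \<Rightarrow> bool" where
  "polyomino P \<longleftrightarrow> finite P \<and> P \<subseteq> range cell \<and>
     (\<forall>C\<in>P. \<forall>D\<in>P. \<exists>Cs. cell_walk P Cs \<and> hd Cs = C \<and> last Cs = D)"

definition vertices :: "point set set \<Rightarrow> point set" where
  "vertices P = \<Union>P"

definition thin :: "point set set \<Rightarrow> bool" where
  "thin P \<longleftrightarrow> \<not> (\<exists>a. {cell a, cell (a + (1, 0)), cell (a + (0, 1)), cell (a + (1, 1))} \<subseteq> P)"

definition cells_in :: "point \<Rightarrow> point \<Rightarrow> point set set" where
  "cells_in a b = {C \<in> range cell. C \<subseteq> {a..b}}"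

definition inner_interval :: "point set set \<Rightarrow> point \<Rightarrow> point \<Rightarrow> bool" where
  "inner_interval P a b \<longleftrightarrow> fst a < fst b \<and> snd a < snd b \<and> cells_in a b \<subseteq> P"

definition maximal_inner_interval :: "point set set \<Rightarrow> point \<Rightarrow> point \<Rightarrow> bool" where
  "maximal_inner_interval P a b \<longleftrightarrow>
     inner_interval P a b \<and> \<not> (\<exists>c d. inner_interval P c d \<and> {a..b} \<subset> {c..d})"

text \<open>Only used for thin polyominoes, whose inner intervals are rows or columns of cells.\<close>

definition interval_length :: "point \<Rightarrow> point \<Rightarrow> nat" where
  "interval_length a b = card (cells_in a b)"

text \<open>
  The cells are indexed from \<open>0\<close> instead of \<open>1\<close>, which does not affect cyclic distances; these are
  computed in \<^typ>\<open>int\<close> to avoid truncated subtraction.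
\<close>

definition cyclic_dist :: "nat \<Rightarrow> nat \<Rightarrow> nat \<Rightarrow> int" where
  "cyclic_dist n i j = min \<bar>int i - int j\<bar> (int n - \<bar>int i - int j\<bar>)"

definition thin_cycle :: "point set set \<Rightarrow> bool" where
  "thin_cycle P \<longleftrightarrow> polyomino P \<and> thin P \<and>
     (\<exists>Cs. set Cs = P \<and> cell_path P Cs \<and>
       (\<exists>e. e \<in> edges (hd Cs) \<and> e \<in> edges (last Cs)) \<and>
       (\<forall>i < length Cs. \<forall>j < length Cs.
          cyclic_dist (length Cs) i j > 2 \<longrightarrow> Cs ! i \<inter> Cs ! j = {}))"


section \<open>Polyomino ideals\<close>

text \<open>
  A polynomial over \<open>'k\<close> in variables of type \<open>'v\<close> is a finitely supported map from monomials to
  coefficients, where a monomial is a finitely supported map from variables to exponents; the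
  multiplication is convolution. The ring below is \<open>'k[x\<^sub>v | v \<in> V]\<close>: its elements are the
  polynomials in which only variables from \<open>V\<close> occur.
\<close>

definition poly_ring_on :: "'v set \<Rightarrow> (('v \<Rightarrow>\<^sub>0 nat) \<Rightarrow>\<^sub>0 'k::field) ring" where
  "poly_ring_on V =
     \<lparr>carrier = {p. \<forall>m \<in> Poly_Mapping.keys p. Poly_Mapping.keys m \<subseteq> V},
      monoid.mult = (*), one = 1, zero = 0, add = (+)\<rparr>"

definition var :: "'v \<Rightarrow> ('v \<Rightarrow>\<^sub>0 nat) \<Rightarrow>\<^sub>0 'k::field" where
  "var v = Poly_Mapping.single (Poly_Mapping.single v 1) 1"

definition polyomino_ring :: "point set set \<Rightarrow> ((point \<Rightarrow>\<^sub>0 nat) \<Rightarrow>\<^sub>0 'k::field) ring" where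
  "polyomino_ring P = poly_ring_on (vertices P)"

text \<open>The anti-diagonal corners of \<open>[a, b]\<close> are \<open>(fst a, snd b)\<close> and \<open>(fst b, snd a)\<close>.\<close>

definition inner_2_minors :: "point set set \<Rightarrow> ((point \<Rightarrow>\<^sub>0 nat) \<Rightarrow>\<^sub>0 'k::field) set" where
  "inner_2_minors P =
     {var a * var b - var (fst a, snd b) * var (fst b, snd a) | a b. inner_interval P a b}"

definition polyomino_ideal :: "point set set \<Rightarrow> ((point \<Rightarrow>\<^sub>0 nat) \<Rightarrow>\<^sub>0 'k::field) set" where
  "polyomino_ideal P = genideal (polyomino_ring P) (inner_2_minors P)"

end

theory Submission
  imports Defs "HOL-Library.Countable"
begin

text \<open>
  The ideal is shown to be the kernel of a toric map, that is, of a homomorphism sending the variables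
  to monomials of another polynomial ring, which is an integral domain.

  The cells form a cyclic sequence of horizontal and vertical runs, and consecutive runs share a
  corner cell. Since all runs have at least three cells, distinct corner cells have no vertex in
  common. A run of \<open>l\<close> cells is a matrix of \<open>2\<close> rows, its tracks, and \<open>l + 1\<close> columns, its rungs; its
  inner intervals give all \<open>2\<close>-minors of this matrix. On a variety given by such minors the matrices
  have rank one, and consecutive ones agree on the \<open>2 \<times> 2\<close> block of their corner cell, up to
  transposition. This suggests the parametrisation: a vertex is sent to the product of the variables of
  its horizontal and its vertical track (for a vertex outside the corner cells, one of these is a
  rung), and of a further variable for the corner cell containing it, if any. Inner \<open>2\<close>-minors are
  sent to \<open>0\<close> (\<open>vertex_weight_minor\<close>).

  Conversely, the kernel is spanned by differences of monomials with the same image, so it suffices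
  that such monomials are congruent modulo the ideal (\<open>mem_if_toric_map_eq_0\<close>). By induction on the
  degree, it suffices to move a given vertex \<open>v\<close> of one monomial into the other
  (\<open>cong_if_exchange\<close>). The equality of the images provides vertices of the other monomial on both tracks
  through \<open>v\<close> and in the corner cell of \<open>v\<close>, and at most two replacements of opposite corners of an inner
  interval by the other two corners produce \<open>v\<close> (\<open>exchange\<close>).

  The cyclic order of the cells enters only through local properties, collected in the locale
  \<open>long_runs\<close>.
\<close>

section \<open>Toric maps and their kernels\<close>

abbreviation monom :: "('v \<Rightarrow>\<^sub>0 nat) \<Rightarrow> ('v \<Rightarrow>\<^sub>0 nat) \<Rightarrow>\<^sub>0 'k::field" where
  "monom m \<equiv> Poly_Mapping.single m 1"

text \<open>
  Variables of the target polynomial ring are natural numbers. The function \<open>w\<close> assigns to every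
  variable \<open>v\<close> the exponent vector \<open>w v\<close> of its image monomial; \<open>weight w m\<close> is then the exponent
  vector of the image of the monomial with exponent vector \<open>m\<close>. Multiplication by \<open>of_nat k\<close> scales an
  exponent vector by \<open>k\<close>.
\<close>

definition weight :: "('v \<Rightarrow> nat \<Rightarrow>\<^sub>0 nat) \<Rightarrow> ('v \<Rightarrow>\<^sub>0 nat) \<Rightarrow> nat \<Rightarrow>\<^sub>0 nat" where
  "weight w m = (\<Sum>v\<in>Poly_Mapping.keys m. of_nat (Poly_Mapping.lookup m v) * w v)"

text \<open>
  The homomorphism of algebras that sends every variable \<open>v\<close> to the monomial \<open>w v\<close>. Its codomain is a
  polynomial ring over a field in linearly ordered variables, hence an integral domain.
\<close>

definition toric_map ::
    "('v \<Rightarrow> nat \<Rightarrow>\<^sub>0 nat) \<Rightarrow> (('v \<Rightarrow>\<^sub>0 nat) \<Rightarrow>\<^sub>0 'k::field) \<Rightarrow> (nat \<Rightarrow>\<^sub>0 nat) \<Rightarrow>\<^sub>0 'k" where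
  "toric_map w p =
     (\<Sum>m\<in>Poly_Mapping.keys p. Poly_Mapping.single (weight w m) (Poly_Mapping.lookup p m))"

lemma weight_zero [simp]: "weight w 0 = 0"
  by (simp add: weight_def)

lemma weight_add: "weight w (m + n) = weight w m + weight w n"
  unfolding weight_def
  by (rule setsum_keys_plus_distrib) (simp_all add: distrib_right)

lemma weight_single [simp]: "weight w (Poly_Mapping.single v 1) = w v"
  by (simp add: weight_def)

lemma lookup_weight:
  "Poly_Mapping.lookup (weight w m) t =
     (\<Sum>v\<in>Poly_Mapping.keys m. Poly_Mapping.lookup m v * Poly_Mapping.lookup (w v) t)"
proof -
  have "Poly_Mapping.lookup (of_nat n * q) t = n * Poly_Mapping.lookup q t" for n and q :: "nat \<Rightarrow>\<^sub>0 nat"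
    by (induction n) (simp_all add: distrib_right lookup_add)
  then show ?thesis
    by (simp add: weight_def lookup_sum)
qed

lemma lookup_weight_pos_iff:
  "Poly_Mapping.lookup (weight w m) t > 0 \<longleftrightarrow>
     (\<exists>v\<in>Poly_Mapping.keys m. Poly_Mapping.lookup (w v) t > 0)"
  by (auto simp: lookup_weight in_keys_iff intro: sum_pos2 simp flip: neq0_conv)

lemma toric_map_add: "toric_map w (p + q) = toric_map w p + toric_map w q"
  unfolding toric_map_def
  by (rule setsum_keys_plus_distrib) (simp_all add: single_add)

lemma toric_map_single [simp]:
  "toric_map w (Poly_Mapping.single m c) = Poly_Mapping.single (weight w m) c"
  by (simp add: toric_map_def)

lemma toric_map_zero [simp]: "toric_map w 0 = 0"
  by (simp add: toric_map_def)

lemma toric_map_diff: "toric_map w (p - q) = toric_map w p - toric_map w q"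
  by (metis add_diff_cancel_right' diff_add_cancel toric_map_add)

lemma toric_map_sum: "toric_map w (\<Sum>i\<in>A. f i) = (\<Sum>i\<in>A. toric_map w (f i))"
  by (induction A rule: infinite_finite_induct) (simp_all add: toric_map_add)

lemma sum_monomials:
  "(\<Sum>m\<in>Poly_Mapping.keys p. Poly_Mapping.single m (Poly_Mapping.lookup p m)) = p"
  by (rule poly_mapping_eqI) (auto simp: lookup_sum lookup_single when_def in_keys_iff)

lemma toric_map_mult: "toric_map w (p * q) = toric_map w p * toric_map w q"
proof -
  let ?s = "\<lambda>p m. Poly_Mapping.single m (Poly_Mapping.lookup p m)"
  have "p * q = (\<Sum>m\<in>Poly_Mapping.keys p. \<Sum>n\<in>Poly_Mapping.keys q. ?s p m * ?s q n)"
    by (subst sum_monomials[of p, symmetric], subst sum_monomials[of q, symmetric])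
       (simp only: sum_product)
  then have "toric_map w (p * q) =
      (\<Sum>m\<in>Poly_Mapping.keys p. \<Sum>n\<in>Poly_Mapping.keys q. toric_map w (?s p m * ?s q n))"
    by (simp add: toric_map_sum)
  also have "\<dots> = (\<Sum>m\<in>Poly_Mapping.keys p. \<Sum>n\<in>Poly_Mapping.keys q.
      toric_map w (?s p m) * toric_map w (?s q n))"
    by (simp add: mult_single weight_add)
  also have "\<dots> = toric_map w p * toric_map w q"
    by (simp only: toric_map_single) (simp add: toric_map_def sum_product)
  finally show ?thesis .
qed

lemma poly_ring_on_simps [simp]:
  "monoid.mult (poly_ring_on V) = (*)" "one (poly_ring_on V) = 1"
  "zero (poly_ring_on V) = 0" "add (poly_ring_on V) = (+)"
  by (simp_all add: poly_ring_on_def)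

lemma in_carrier_poly_ring_on:
  "p \<in> carrier (poly_ring_on V) \<longleftrightarrow> (\<forall>m\<in>Poly_Mapping.keys p. Poly_Mapping.keys m \<subseteq> V)"
  by (simp add: poly_ring_on_def)

lemma monom_in_carrier: "Poly_Mapping.keys m \<subseteq> V \<Longrightarrow> Poly_Mapping.single m c \<in> carrier (poly_ring_on V)"
  by (simp add: in_carrier_poly_ring_on)

lemma zero_in_carrier: "0 \<in> carrier (poly_ring_on V)"
  by (simp add: in_carrier_poly_ring_on)

lemma one_in_carrier: "(1 :: _ \<Rightarrow>\<^sub>0 'k::field) \<in> carrier (poly_ring_on V)"
  by (simp add: in_carrier_poly_ring_on)

lemma add_in_carrier:
  "p \<in> carrier (poly_ring_on V) \<Longrightarrow> q \<in> carrier (poly_ring_on V) \<Longrightarrow> p + q \<in> carrier (poly_ring_on V)"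
  using keys_add[of p q] by (auto simp: in_carrier_poly_ring_on)

lemma uminus_in_carrier: "p \<in> carrier (poly_ring_on V) \<Longrightarrow> - p \<in> carrier (poly_ring_on V)"
  by (simp add: in_carrier_poly_ring_on in_keys_iff)

lemma diff_in_carrier:
  "p \<in> carrier (poly_ring_on V) \<Longrightarrow> q \<in> carrier (poly_ring_on V) \<Longrightarrow> p - q \<in> carrier (poly_ring_on V)"
  using add_in_carrier[OF _ uminus_in_carrier, of p V q] by simp

lemma keys_add_eq:
  fixes m n :: "'v \<Rightarrow>\<^sub>0 nat"
  shows "Poly_Mapping.keys (m + n) = Poly_Mapping.keys m \<union> Poly_Mapping.keys n"
  by (auto simp: in_keys_iff lookup_add)

lemma mult_in_carrier:
  assumes "p \<in> carrier (poly_ring_on V)" "q \<in> carrier (poly_ring_on V)"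
  shows "p * q \<in> carrier (poly_ring_on V)"
proof -
  have "Poly_Mapping.keys m \<subseteq> V" if m: "m \<in> Poly_Mapping.keys (p * q)" for m
  proof -
    obtain a b where "m = a + b" "a \<in> Poly_Mapping.keys p" "b \<in> Poly_Mapping.keys q"
      using subsetD[OF keys_mult m] by auto
    then show ?thesis
      using assms by (simp add: in_carrier_poly_ring_on keys_add_eq)
  qed
  then show ?thesis
    by (simp add: in_carrier_poly_ring_on)
qed

lemma cring_poly_ring_on: "cring (poly_ring_on V)"
proof (rule cringI)
  show "abelian_group (poly_ring_on V)"
  proof (rule abelian_groupI)
    show "\<exists>y\<in>carrier (poly_ring_on V). y \<oplus>\<^bsub>poly_ring_on V\<^esub> x = \<zero>\<^bsub>poly_ring_on V\<^esub>"
      if "x \<in> carrier (poly_ring_on V)" for x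
      using that uminus_in_carrier by (intro bexI[of _ "- x"]) auto
  qed (auto simp: add_in_carrier zero_in_carrier algebra_simps)
  show "comm_monoid (poly_ring_on V)"
    by (rule comm_monoidI) (auto simp: mult_in_carrier one_in_carrier algebra_simps)
qed (simp add: algebra_simps)

lemma ideal_poly_ring_onI:
  assumes "I \<subseteq> carrier (poly_ring_on V)" "0 \<in> I" "\<And>p q. p \<in> I \<Longrightarrow> q \<in> I \<Longrightarrow> p + q \<in> I"
    "\<And>p q. p \<in> I \<Longrightarrow> q \<in> carrier (poly_ring_on V) \<Longrightarrow> q * p \<in> I"
  shows "ideal I (poly_ring_on V)"
proof -
  interpret cring "poly_ring_on V" by (rule cring_poly_ring_on)
  have inv: "\<ominus>\<^bsub>poly_ring_on V\<^esub> p = - 1 * p" if "p \<in> carrier (poly_ring_on V)" for p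
    using that by (intro minus_equality) (auto simp: uminus_in_carrier)
  show ?thesis
  proof (rule idealI)
    show "subgroup I (add_monoid (poly_ring_on V))"
    proof (rule add.subgroupI)
      show "\<ominus>\<^bsub>poly_ring_on V\<^esub> p \<in> I" if "p \<in> I" for p
        using that assms(1) assms(4)[OF that, of "- 1"] inv[of p]
        by (auto simp: uminus_in_carrier one_in_carrier)
    qed (use assms in auto)
  qed (use assms in \<open>auto simp: ring_axioms mult.commute\<close>)
qed

text \<open>An ideal of the polynomial ring in the variables \<open>V\<close>.\<close>

locale poly_ideal =
  fixes V :: "'v set" and I :: "(('v \<Rightarrow>\<^sub>0 nat) \<Rightarrow>\<^sub>0 'k::field) set"
  assumes ideal: "ideal I (poly_ring_on V)"
begin

interpretation ideal I "poly_ring_on V" by (rule ideal)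

lemma zero_mem: "0 \<in> I"
  using additive_subgroup.zero_closed[OF is_additive_subgroup] by simp

lemma add_mem: "p \<in> I \<Longrightarrow> q \<in> I \<Longrightarrow> p + q \<in> I"
  using additive_subgroup.a_closed[OF is_additive_subgroup, of p q] by simp

lemma mult_mem: "q \<in> carrier (poly_ring_on V) \<Longrightarrow> p \<in> I \<Longrightarrow> q * p \<in> I"
  using I_l_closed[of p q] by simp

lemma uminus_mem: "p \<in> I \<Longrightarrow> - p \<in> I"
  using mult_mem[of "- 1" p] by (simp add: in_carrier_poly_ring_on)

text \<open>Congruence of monomials modulo the ideal.\<close>

definition cong :: "('v \<Rightarrow>\<^sub>0 nat) \<Rightarrow> ('v \<Rightarrow>\<^sub>0 nat) \<Rightarrow> bool" where
  "cong m n \<longleftrightarrow> monom m - monom n \<in> I"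

lemma cong_refl: "cong m m"
  by (simp add: cong_def zero_mem)

lemma cong_trans: "cong m n \<Longrightarrow> cong n k \<Longrightarrow> cong m k"
  using add_mem[of "monom m - monom n" "monom n - monom k"] by (simp add: cong_def)

lemma cong_sym: "cong m n \<Longrightarrow> cong n m"
  using uminus_mem[of "monom m - monom n"] by (simp add: cong_def)

lemma cong_add: "cong m n \<Longrightarrow> Poly_Mapping.keys k \<subseteq> V \<Longrightarrow> cong (k + m) (k + n)"
  using mult_mem[OF monom_in_carrier[of k V 1], of "monom m - monom n"]
  by (simp add: cong_def algebra_simps mult_single)

text \<open>
  Division by a common variable turns a rule that makes one variable common to two monomials of
  equal weight into a proof that such monomials are congruent.
\<close>

lemma cong_if_exchange:
  assumes exch: "\<And>m n v. \<lbrakk>Poly_Mapping.keys m \<subseteq> V; Poly_Mapping.keys n \<subseteq> V; weight w m = weight w n;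
      v \<in> Poly_Mapping.keys n\<rbrakk> \<Longrightarrow>
      \<exists>m'. Poly_Mapping.keys m' \<subseteq> V \<and> weight w m' = weight w m \<and> cong m m' \<and> v \<in> Poly_Mapping.keys m'"
    and nonzero: "\<And>v. v \<in> V \<Longrightarrow> w v \<noteq> 0"
    and "Poly_Mapping.keys m \<subseteq> V" "Poly_Mapping.keys n \<subseteq> V" "weight w m = weight w n"
  shows "cong m n"
  using assms(3-)
proof (induction "\<Sum>v\<in>Poly_Mapping.keys n. Poly_Mapping.lookup n v" arbitrary: m n rule: less_induct)
  case less
  show ?case
  proof (cases "n = 0")
    case True
    have "Poly_Mapping.keys m = {}"
    proof (rule ccontr)
      assume "Poly_Mapping.keys m \<noteq> {}"
      then obtain v where v: "v \<in> Poly_Mapping.keys m" by blast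
      then obtain t where "Poly_Mapping.lookup (w v) t > 0"
        using nonzero[of v] less.prems(1) by (metis subsetD neq0_conv poly_mapping_eqI lookup_zero)
      then have "Poly_Mapping.lookup (weight w m) t > 0"
        using v lookup_weight_pos_iff by blast
      then show False using True less.prems by simp
    qed
    then show ?thesis using True cong_refl by simp
  next
    case False
    then obtain v where v: "v \<in> Poly_Mapping.keys n"
      by (metis keys_eq_empty equals0I)
    then obtain m' where m': "Poly_Mapping.keys m' \<subseteq> V" "weight w m' = weight w m" "cong m m'"
        "v \<in> Poly_Mapping.keys m'"
      using exch less.prems by metis
    let ?x = "Poly_Mapping.single v (1::nat)"
    have split: "k = ?x + (k - ?x)" if "v \<in> Poly_Mapping.keys k" for k :: "'v \<Rightarrow>\<^sub>0 nat"
      using that by (intro poly_mapping_eqI)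
        (auto simp: lookup_add lookup_minus lookup_single when_def in_keys_iff)
    have eqs: "m' = ?x + (m' - ?x)" "n = ?x + (n - ?x)"
      using split v m'(4) by blast+
    have sub: "Poly_Mapping.keys (m' - ?x) \<subseteq> V" "Poly_Mapping.keys (n - ?x) \<subseteq> V"
      using m'(1) less.prems(2) eqs by (metis keys_add_eq Un_subset_iff)+
    have "w v + weight w (m' - ?x) = w v + weight w (n - ?x)"
      using eqs m'(2) less.prems(3) by (metis weight_add weight_single)
    then have "weight w (m' - ?x) = weight w (n - ?x)" by simp
    moreover have "(\<Sum>u\<in>Poly_Mapping.keys (n - ?x). Poly_Mapping.lookup (n - ?x) u) <
        (\<Sum>u\<in>Poly_Mapping.keys n. Poly_Mapping.lookup n u)"
    proof -
      have "(\<Sum>u\<in>Poly_Mapping.keys (?x + (n - ?x)). Poly_Mapping.lookup (?x + (n - ?x)) u) =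
          (\<Sum>u\<in>Poly_Mapping.keys ?x. Poly_Mapping.lookup ?x u) +
          (\<Sum>u\<in>Poly_Mapping.keys (n - ?x). Poly_Mapping.lookup (n - ?x) u)"
        by (rule setsum_keys_plus_distrib) simp_all
      then show ?thesis using eqs(2) by simp
    qed
    ultimately have "cong (m' - ?x) (n - ?x)"
      using less.hyps sub by blast
    moreover have "Poly_Mapping.keys ?x \<subseteq> V"
      using v less.prems(2) by auto
    ultimately have "cong m' n"
      using cong_add[of "m' - ?x" "n - ?x" ?x] eqs by metis
    then show ?thesis using m'(3) cong_trans by blast
  qed
qed

text \<open>
  If monomials of equal weight are congruent, the kernel of the toric map lies in the ideal: a
  monomial of a kernel element cannot be alone in its weight, so it can be traded for another
  monomial of the element.
\<close>

lemma mem_if_toric_map_eq_0: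
  assumes cong: "\<And>m n. \<lbrakk>Poly_Mapping.keys m \<subseteq> V; Poly_Mapping.keys n \<subseteq> V; weight w m = weight w n\<rbrakk> \<Longrightarrow> cong m n"
    and "p \<in> carrier (poly_ring_on V)" "toric_map w p = 0"
  shows "p \<in> I"
  using assms(2,3)
proof (induction "card (Poly_Mapping.keys p)" arbitrary: p rule: less_induct)
  case less
  show ?case
  proof (cases "p = 0")
    case True
    then show ?thesis using zero_mem by simp
  next
    case False
    then obtain m where m: "m \<in> Poly_Mapping.keys p"
      by (metis keys_eq_empty equals0I)
    let ?c = "Poly_Mapping.lookup p m"
    have "\<exists>n\<in>Poly_Mapping.keys p. n \<noteq> m \<and> weight w n = weight w m"
    proof (rule ccontr)
      assume "\<not> ?thesis"
      then have "Poly_Mapping.lookup (toric_map w p) (weight w m) = (\<Sum>n\<in>Poly_Mapping.keys p. if n = m then ?c else 0)"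
        unfolding toric_map_def lookup_sum
        by (intro sum.cong) (auto simp: lookup_single when_def)
      also have "\<dots> = ?c" using m by simp
      finally show False using less.prems m by (simp add: in_keys_iff)
    qed
    then obtain n where n: "n \<in> Poly_Mapping.keys p" "n \<noteq> m" "weight w n = weight w m" by blast
    have sub: "Poly_Mapping.keys m \<subseteq> V" "Poly_Mapping.keys n \<subseteq> V"
      using m n less.prems by (auto simp: in_carrier_poly_ring_on)
    define b where "b = Poly_Mapping.single 0 ?c * (monom m - monom n)"
    have b: "b = Poly_Mapping.single m ?c - Poly_Mapping.single n ?c"
      by (simp add: b_def algebra_simps mult_single)
    have "b \<in> I"
      unfolding b_def using cong[OF sub] n(3)
      by (intro mult_mem monom_in_carrier) (auto simp: cong_def)
    have "Poly_Mapping.keys (p - b) \<subseteq> Poly_Mapping.keys p - {m}"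
      using m n by (auto simp: b in_keys_iff lookup_minus lookup_single when_def split: if_splits)
    then have "card (Poly_Mapping.keys (p - b)) < card (Poly_Mapping.keys p)"
      using m by (intro psubset_card_mono) auto
    moreover have "p - b \<in> carrier (poly_ring_on V)"
      using less.prems sub by (auto simp: b intro!: diff_in_carrier monom_in_carrier)
    moreover have "toric_map w (p - b) = 0"
      using less.prems n(3) by (simp add: toric_map_diff b)
    ultimately have "p - b \<in> I" using less.hyps by blast
    then have "(p - b) + b \<in> I" using \<open>b \<in> I\<close> add_mem by blast
    then show ?thesis by simp
  qed
qed

lemma weight_eq_if_cong:
  assumes ker: "\<And>p. p \<in> I \<Longrightarrow> toric_map w p = 0" and "cong m n"
  shows "weight w m = weight w n"
proof -
  have "toric_map w (monom m - monom n :: (_ \<Rightarrow>\<^sub>0 'k)) = 0"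
    using assms by (simp add: cong_def)
  then have "Poly_Mapping.single (weight w m) (1::'k) = Poly_Mapping.single (weight w n) 1"
    by (simp add: toric_map_diff)
  then show ?thesis
    by (metis keys_single singleton_inject zero_neq_one)
qed

lemma primeideal_if_exchange:
  assumes ker: "\<And>p. p \<in> I \<Longrightarrow> toric_map w p = 0"
    and nonzero: "\<And>v. v \<in> V \<Longrightarrow> w v \<noteq> 0"
    and exch: "\<And>m n v. \<lbrakk>Poly_Mapping.keys m \<subseteq> V; Poly_Mapping.keys n \<subseteq> V; weight w m = weight w n;
      v \<in> Poly_Mapping.keys n\<rbrakk> \<Longrightarrow>
      \<exists>m'. Poly_Mapping.keys m' \<subseteq> V \<and> v \<in> Poly_Mapping.keys m' \<and> cong m m'"
  shows "primeideal I (poly_ring_on V)"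
proof -
  have "cong m n" if "Poly_Mapping.keys m \<subseteq> V" "Poly_Mapping.keys n \<subseteq> V" "weight w m = weight w n" for m n
  proof (rule cong_if_exchange[of w])
    fix m n v
    assume "Poly_Mapping.keys m \<subseteq> V" "Poly_Mapping.keys n \<subseteq> V" "weight w m = weight w n"
      "v \<in> Poly_Mapping.keys n"
    then show "\<exists>m'. Poly_Mapping.keys m' \<subseteq> V \<and> weight w m' = weight w m \<and> cong m m' \<and> v \<in> Poly_Mapping.keys m'"
      using exch weight_eq_if_cong[OF ker] by metis
  qed (use that nonzero in auto)
  then have mem: "p \<in> I" if "p \<in> carrier (poly_ring_on V)" "toric_map w p = 0" for p
    using mem_if_toric_map_eq_0 that by blast
  show ?thesis
  proof (rule primeidealI)
    have "toric_map w (1 :: _ \<Rightarrow>\<^sub>0 'k) = 1"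
      by (simp flip: single_one)
    then have "1 \<notin> I"
      using ker[of 1] by auto
    then show "carrier (poly_ring_on V) \<noteq> I"
      using one_in_carrier[of V] by metis
    show "p \<in> I \<or> q \<in> I"
      if "p \<in> carrier (poly_ring_on V)" "q \<in> carrier (poly_ring_on V)"
        "p \<otimes>\<^bsub>poly_ring_on V\<^esub> q \<in> I" for p q
    proof -
      have "toric_map w p * toric_map w q = 0"
        using ker[OF that(3)] by (simp add: toric_map_mult)
      then show ?thesis
        using mem that(1,2) by auto
    qed
  qed (rule ideal cring_poly_ring_on)+
qed

text \<open>A binomial \<open>ab - cd\<close> of the ideal replaces the factor \<open>ab\<close> of a monomial by \<open>cd\<close>.\<close>

lemma cong_exchange:
  assumes "Poly_Mapping.keys m \<subseteq> V" "a \<in> Poly_Mapping.keys m" "b \<in> Poly_Mapping.keys m" "a \<noteq> b"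
    and "c \<in> V" "d \<in> V" and mem: "var a * var b - var c * var d \<in> I"
  shows "\<exists>m'. Poly_Mapping.keys m' \<subseteq> V \<and> c \<in> Poly_Mapping.keys m' \<and> cong m m'"
proof -
  let ?x = "\<lambda>v. Poly_Mapping.single v (1::nat)"
  define k where "k = m - (?x a + ?x b)"
  have m: "m = k + (?x a + ?x b)"
    using assms(2-4) unfolding k_def
    by (intro poly_mapping_eqI) (auto simp: lookup_add lookup_minus lookup_single when_def in_keys_iff)
  have k: "Poly_Mapping.keys k \<subseteq> V"
    using assms(1) unfolding m keys_add_eq by simp
  have "cong (?x a + ?x b) (?x c + ?x d)"
    using mem by (simp add: cong_def var_def mult_single)
  then have "cong m (k + (?x c + ?x d))"
    using cong_add k m by metis
  then show ?thesis
    using k assms(5,6) by (intro exI[of _ "k + (?x c + ?x d)"]) (simp add: keys_add_eq)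
qed

end

lemma toric_map_genideal:
  assumes S: "S \<subseteq> carrier (poly_ring_on V)" "\<And>s. s \<in> S \<Longrightarrow> toric_map w s = 0"
    and p: "p \<in> genideal (poly_ring_on V) S"
  shows "toric_map w p = 0"
proof -
  let ?ker = "{p \<in> carrier (poly_ring_on V). toric_map w p = 0}"
  have "ideal ?ker (poly_ring_on V)"
    by (rule ideal_poly_ring_onI)
       (auto simp: add_in_carrier mult_in_carrier toric_map_add toric_map_mult zero_in_carrier)
  then have "genideal (poly_ring_on V) S \<subseteq> ?ker"
    using S cring.axioms(1)[OF cring_poly_ring_on] by (intro ring.genideal_minimal) auto
  then show ?thesis using p by blast
qed

section \<open>Sets of cells all of whose runs are long\<close>

text \<open>
  A set of cells is given by a predicate on the integer coordinates of the lower left corners, so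
  that neighbours of a cell can be addressed without truncated subtraction. Transposition exchanges
  rows and columns.
\<close>

definition transposed :: "(int \<Rightarrow> int \<Rightarrow> bool) \<Rightarrow> int \<Rightarrow> int \<Rightarrow> bool" where
  "transposed Q x y = Q y x"

text \<open>The cell has a neighbour in its row (\<open>hor\<close>) or in its column (\<open>ver\<close>).\<close>

definition hor :: "(int \<Rightarrow> int \<Rightarrow> bool) \<Rightarrow> int \<Rightarrow> int \<Rightarrow> bool" where
  "hor Q x y \<longleftrightarrow> Q x y \<and> (Q (x - 1) y \<or> Q (x + 1) y)"

definition ver :: "(int \<Rightarrow> int \<Rightarrow> bool) \<Rightarrow> int \<Rightarrow> int \<Rightarrow> bool" where
  "ver Q x y \<longleftrightarrow> Q x y \<and> (Q x (y - 1) \<or> Q x (y + 1))"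

text \<open>
  A corner cell is one where a horizontal and a vertical run meet. This is the set of the corner
  cells that have the lattice point \<open>(x, y)\<close> as a vertex.
\<close>

definition corners_at :: "(int \<Rightarrow> int \<Rightarrow> bool) \<Rightarrow> int \<Rightarrow> int \<Rightarrow> (int \<times> int) set" where
  "corners_at Q x y =
     {(i, j). hor Q i j \<and> ver Q i j \<and> i \<le> x \<and> x \<le> i + 1 \<and> j \<le> y \<and> y \<le> j + 1}"

text \<open>The edge from \<open>(x, y)\<close> to \<open>(x + 1, y)\<close> belongs to some cell.\<close>

definition hedge :: "(int \<Rightarrow> int \<Rightarrow> bool) \<Rightarrow> int \<Rightarrow> int \<Rightarrow> bool" where
  "hedge Q x y \<longleftrightarrow> Q x y \<or> Q x (y - 1)"

text \<open>
  A horizontal track is a maximal chain of consecutive horizontal edges, possibly a single point;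
  \<open>track Q y x\<close> is the first coordinate of the leftmost point of the track through \<open>(x, y)\<close>. Vertical
  tracks are the horizontal tracks of the transposed set.
\<close>

fun track :: "(int \<Rightarrow> int \<Rightarrow> bool) \<Rightarrow> int \<Rightarrow> nat \<Rightarrow> nat" where
  "track Q y 0 = 0"
| "track Q y (Suc x) = (if hedge Q (int x) y then track Q y x else Suc x)"

lemma hor_transposed: "hor (transposed Q) x y \<longleftrightarrow> ver Q y x"
  by (simp add: hor_def ver_def transposed_def)

lemma ver_transposed: "ver (transposed Q) x y \<longleftrightarrow> hor Q y x"
  by (simp add: hor_def ver_def transposed_def)

lemma corners_at_transposed: "corners_at (transposed Q) x y = prod.swap ` corners_at Q y x"
  by (auto simp: corners_at_def hor_transposed ver_transposed image_iff)

lemma finite_corners_at: "finite (corners_at Q x y)"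
  by (rule finite_subset[of _ "{x - 1..x} \<times> {y - 1..y}"]) (auto simp: corners_at_def)

lemma track_le: "track Q y x \<le> x"
  by (induction x) auto

lemma track_eqI:
  assumes "x \<le> x'" "\<And>t. x \<le> t \<Longrightarrow> t < x' \<Longrightarrow> hedge Q (int t) y"
  shows "track Q y x = track Q y x'"
  using assms
proof (induction x' rule: dec_induct)
  case (step n)
  have "hedge Q (int n) y" using step.hyps step.prems by simp
  moreover have "track Q y x = track Q y n" using step.prems by (intro step.IH) simp
  ultimately show ?case by simp
qed simp

lemma hedge_if_track_eq:
  assumes "track Q y x = track Q y x'" "x \<le> t" "t < x'"
  shows "hedge Q (int t) y"
  using assms
proof (induction x' arbitrary: t)
  case (Suc x')
  have "track Q y (Suc x') \<noteq> Suc x'"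
    using Suc.prems track_le[of Q y x] by linarith
  then have edge: "hedge Q (int x') y" by (simp split: if_splits)
  then have "track Q y x = track Q y x'"
    using Suc.prems(1) by simp
  then show ?case
    using Suc.IH[of t] Suc.prems(2,3) edge by (cases "t = x'") simp_all
qed simp

text \<open>
  The local properties of a thin cycle with long maximal intervals on which the whole argument
  rests: a cell with two neighbours on opposite sides has no further neighbour, two cells that meet
  in a single vertex have a common neighbour, no run consists of exactly two cells, and no cell is
  isolated.
\<close>

locale long_runs =
  fixes Q :: "int \<Rightarrow> int \<Rightarrow> bool"
  assumes branch_hor: "\<lbrakk>Q x y; Q (x - 1) y; Q (x + 1) y\<rbrakk> \<Longrightarrow> \<not> Q x (y - 1) \<and> \<not> Q x (y + 1)"
    and branch_ver: "\<lbrakk>Q x y; Q x (y - 1); Q x (y + 1)\<rbrakk> \<Longrightarrow> \<not> Q (x - 1) y \<and> \<not> Q (x + 1) y"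
    and diagonal: "\<lbrakk>Q x y; Q (x + 1) (y + 1)\<rbrakk> \<Longrightarrow> Q (x + 1) y \<or> Q x (y + 1)"
    and antidiagonal: "\<lbrakk>Q (x + 1) y; Q x (y + 1)\<rbrakk> \<Longrightarrow> Q x y \<or> Q (x + 1) (y + 1)"
    and long_hor: "\<lbrakk>Q x y; Q (x + 1) y\<rbrakk> \<Longrightarrow> Q (x - 1) y \<or> Q (x + 2) y"
    and long_ver: "\<lbrakk>Q x y; Q x (y + 1)\<rbrakk> \<Longrightarrow> Q x (y - 1) \<or> Q x (y + 2)"
    and not_isolated: "Q x y \<Longrightarrow> hor Q x y \<or> ver Q x y"
begin

lemma long_runs_transposed: "long_runs (transposed Q)"
proof
  fix x y
  show "\<lbrakk>transposed Q x y; transposed Q (x - 1) y; transposed Q (x + 1) y\<rbrakk> \<Longrightarrow>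
      \<not> transposed Q x (y - 1) \<and> \<not> transposed Q x (y + 1)"
    unfolding transposed_def by (rule branch_ver)
  show "\<lbrakk>transposed Q x y; transposed Q x (y - 1); transposed Q x (y + 1)\<rbrakk> \<Longrightarrow>
      \<not> transposed Q (x - 1) y \<and> \<not> transposed Q (x + 1) y"
    unfolding transposed_def by (rule branch_hor)
  show "\<lbrakk>transposed Q x y; transposed Q (x + 1) (y + 1)\<rbrakk> \<Longrightarrow>
      transposed Q (x + 1) y \<or> transposed Q x (y + 1)"
    unfolding transposed_def using diagonal[of y x] by blast
  show "\<lbrakk>transposed Q (x + 1) y; transposed Q x (y + 1)\<rbrakk> \<Longrightarrow>
      transposed Q x y \<or> transposed Q (x + 1) (y + 1)"
    unfolding transposed_def using antidiagonal[of y x] by blast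
  show "\<lbrakk>transposed Q x y; transposed Q (x + 1) y\<rbrakk> \<Longrightarrow> transposed Q (x - 1) y \<or> transposed Q (x + 2) y"
    unfolding transposed_def by (rule long_ver)
  show "\<lbrakk>transposed Q x y; transposed Q x (y + 1)\<rbrakk> \<Longrightarrow> transposed Q x (y - 1) \<or> transposed Q x (y + 2)"
    unfolding transposed_def by (rule long_hor)
  show "transposed Q x y \<Longrightarrow> hor (transposed Q) x y \<or> ver (transposed Q) x y"
    using not_isolated[of y x] by (auto simp: hor_transposed ver_transposed transposed_def)
qed

lemma corner_cells_not_adjacent:
  assumes "hor Q x y" "ver Q x y"
  shows "\<not> (hor Q (x + 1) y \<and> ver Q (x + 1) y)" "\<not> (hor Q x (y + 1) \<and> ver Q x (y + 1))"
proof -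
  have Q: "Q x y" "Q (x - 1) y \<or> Q (x + 1) y" "Q x (y - 1) \<or> Q x (y + 1)"
    using assms by (simp_all add: hor_def ver_def)
  show "\<not> (hor Q (x + 1) y \<and> ver Q (x + 1) y)"
  proof
    assume "hor Q (x + 1) y \<and> ver Q (x + 1) y"
    then have Q': "Q (x + 1) y" "Q (x + 1) (y - 1) \<or> Q (x + 1) (y + 1)"
      by (simp_all add: hor_def ver_def)
    have "\<not> Q (x - 1) y" "\<not> Q (x + 2) y"
      using Q Q' branch_hor[of x y] branch_hor[of "x + 1" y] by (auto simp: add.commute[of 2 x])
    then show False using long_hor Q(1) Q'(1) by blast
  qed
  show "\<not> (hor Q x (y + 1) \<and> ver Q x (y + 1))"
  proof
    assume "hor Q x (y + 1) \<and> ver Q x (y + 1)"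
    then have Q': "Q x (y + 1)" "Q (x - 1) (y + 1) \<or> Q (x + 1) (y + 1)"
      by (simp_all add: hor_def ver_def)
    have "\<not> Q x (y - 1)" "\<not> Q x (y + 2)"
      using Q Q' branch_ver[of x y] branch_ver[of x "y + 1"] by (auto simp: add.commute[of 2 y])
    then show False using long_ver Q(1) Q'(1) by blast
  qed
qed

lemma corner_cells_not_diagonal:
  assumes "hor Q x y" "ver Q x y"
  shows "\<not> (hor Q (x + 1) (y + 1) \<and> ver Q (x + 1) (y + 1))"
    "\<not> (hor Q (x + 1) (y - 1) \<and> ver Q (x + 1) (y - 1))"
proof -
  have Q: "Q x y" using assms by (simp add: hor_def)
  show "\<not> (hor Q (x + 1) (y + 1) \<and> ver Q (x + 1) (y + 1))"
  proof
    assume *: "hor Q (x + 1) (y + 1) \<and> ver Q (x + 1) (y + 1)"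
    then have Q': "Q (x + 1) (y + 1)" by (simp add: hor_def)
    from diagonal[OF Q Q'] show False
    proof
      assume "Q (x + 1) y"
      then have "hor Q (x + 1) y" "ver Q (x + 1) y" using Q Q' by (simp_all add: hor_def ver_def)
      then show False using corner_cells_not_adjacent(1)[OF assms] by blast
    next
      assume "Q x (y + 1)"
      then have "hor Q x (y + 1)" "ver Q x (y + 1)" using Q Q' by (simp_all add: hor_def ver_def)
      then show False using corner_cells_not_adjacent(2)[OF assms] by blast
    qed
  qed
  show "\<not> (hor Q (x + 1) (y - 1) \<and> ver Q (x + 1) (y - 1))"
  proof
    assume *: "hor Q (x + 1) (y - 1) \<and> ver Q (x + 1) (y - 1)"
    then have Q': "Q (x + 1) (y - 1)" by (simp add: hor_def)
    from antidiagonal[of x "y - 1"] Q Q' have "Q x (y - 1) \<or> Q (x + 1) y" by simp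
    then show False
    proof
      assume "Q (x + 1) y"
      then have "hor Q (x + 1) y" "ver Q (x + 1) y" using Q Q' by (simp_all add: hor_def ver_def)
      then show False using corner_cells_not_adjacent(1)[OF assms] by blast
    next
      assume "Q x (y - 1)"
      then have "hor Q x (y - 1)" "ver Q x (y - 1)" using Q Q' by (simp_all add: hor_def ver_def)
      then show False using corner_cells_not_adjacent(2)[of x "y - 1"] assms by simp
    qed
  qed
qed

text \<open>Distinct corner cells have no vertex in common.\<close>

lemma corner_cells_disjoint:
  assumes "hor Q x y" "ver Q x y" "hor Q x' y'" "ver Q x' y'" "\<bar>x - x'\<bar> \<le> 1" "\<bar>y - y'\<bar> \<le> 1"
  shows "x = x' \<and> y = y'"
proof -
  have "x' = x \<or> x' = x + 1 \<or> x = x' + 1" "y' = y \<or> y' = y + 1 \<or> y = y' + 1"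
    using assms(5,6) by linarith+
  then show ?thesis
    using assms(1-4) corner_cells_not_adjacent[OF assms(1,2)] corner_cells_not_adjacent[OF assms(3,4)]
      corner_cells_not_diagonal[OF assms(1,2)] corner_cells_not_diagonal[OF assms(3,4)]
    by (elim disjE) simp_all
qed

lemma no_square: "\<not> (Q x y \<and> Q (x + 1) y \<and> Q x (y + 1) \<and> Q (x + 1) (y + 1))"
  using corner_cells_not_adjacent[of x y] by (auto simp: hor_def ver_def)

text \<open>
  If a cell in the row above or below meets a cell of a horizontal run that is not a corner cell, then
  the run turns at a neighbour of the latter.
\<close>

lemma cell_above_or_below:
  assumes "hor Q i j" "Q k l" "\<bar>k - i\<bar> \<le> 1" "l = j - 1 \<or> l = j + 1" "\<not> ver Q i j"
  shows "hor Q k j \<and> ver Q k j \<and> \<bar>k - i\<bar> = 1"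
proof -
  have "k \<noteq> i" using assms by (auto simp: hor_def ver_def)
  then have k: "k = i + 1 \<or> k = i - 1" using assms(3) by linarith
  have nQ: "\<not> Q i l" "Q i j" using assms by (auto simp: hor_def ver_def)
  have "Q k j"
    using k assms(2,4) nQ diagonal[of i j] diagonal[of "i - 1" "j - 1"]
      antidiagonal[of i "j - 1"] antidiagonal[of "i - 1" j]
    by auto
  then show ?thesis
    using k assms(2,4) nQ by (auto simp: hor_def ver_def)
qed

text \<open>
  A track does not leave its run: if it continued along a cell on the other side, the two cells
  would meet in a single vertex, and the first of them and the neighbour that they have in common would
  be adjacent corner cells.
\<close>

lemma hor_step:
  assumes "hor Q t j" "hedge Q s y" "\<bar>s - t\<bar> = 1" "y = j \<or> y = j + 1"
  shows "hor Q s j"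
proof -
  have Qt: "Q t j" using assms(1) by (simp add: hor_def)
  have "Q s j"
  proof (rule ccontr)
    assume nQ: "\<not> Q s j"
    obtain l where l: "Q s l" "l = j - 1 \<or> l = j + 1"
      using assms(2,4) nQ by (auto simp: hedge_def)
    have s: "s = t + 1 \<or> s = t - 1" using assms(3) by linarith
    have "Q t l"
      using s l nQ Qt diagonal[of t j] diagonal[of "t - 1" "j - 1"]
        antidiagonal[of t "j - 1"] antidiagonal[of "t - 1" j]
      by auto
    then have "ver Q t j" "hor Q t l" "ver Q t l"
      using l Qt s by (auto simp: hor_def ver_def)
    then show False
      using corner_cells_disjoint[of t j t l] assms(1) l(2) by auto
  qed
  moreover have "t = s - 1 \<or> t = s + 1" using assms(3) by linarith
  ultimately show ?thesis using Qt by (auto simp: hor_def)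
qed

lemma hor_along_track_right:
  assumes "hor Q i j" "x = i \<or> x = i + 1" "y = j \<or> y = j + 1" "x \<le> s" "\<And>t. x \<le> t \<Longrightarrow> t \<le> s \<Longrightarrow> hedge Q t y"
  shows "hor Q s j"
  using assms(4,5)
proof (induction s rule: int_ge_induct)
  case base
  then show ?case using assms(1-3) hor_step[of i j x y] by auto
next
  case (step s)
  then show ?case using hor_step[of s j "s + 1" y] assms(3) by simp
qed

lemma hor_along_track_left:
  assumes "hor Q i j" "x = i \<or> x = i + 1" "y = j \<or> y = j + 1" "s \<le> x - 1"
    "\<And>t. s \<le> t \<Longrightarrow> t < x \<Longrightarrow> hedge Q t y"
  shows "hor Q s j"
  using assms(4,5)
proof (induction s rule: int_le_induct)
  case base
  then show ?case using assms(1-3) hor_step[of i j "x - 1" y] by auto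
next
  case (step s)
  then show ?case using hor_step[of s j "s - 1" y] assms(3) by simp
qed

lemma cells_between_if_track_eq:
  assumes "hor Q i j" "int x = i \<or> int x = i + 1" "y = j \<or> y = j + 1"
    "track Q y x = track Q y x'" "min x x' \<le> t" "t < max x x'"
  shows "Q (int t) j"
proof (cases "x \<le> x'")
  case True
  have "hedge Q s y" if "int x \<le> s" "s \<le> int t" for s
    using hedge_if_track_eq[OF assms(4), of "nat s"] that True assms(5,6) by simp
  then have "hor Q (int t) j"
    using hor_along_track_right[OF assms(1-3), of "int t"] True assms(5) by simp
  then show ?thesis by (simp add: hor_def)
next
  case False
  have "hedge Q s y" if "int t \<le> s" "s < int x" for s
    using hedge_if_track_eq[OF assms(4)[symmetric], of "nat s"] that False assms(5,6) by simp
  then have "hor Q (int t) j"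
    using hor_along_track_left[OF assms(1-3), of "int t"] False assms(6) by simp
  then show ?thesis by (simp add: hor_def)
qed

text \<open>
  The two ends of a rung of a horizontal run belong to the same corner cells.
\<close>

lemma corners_at_mem_opposite:
  assumes "hor Q i j" "x = i \<or> x = i + 1" "y = j \<or> y = j + 1" "y' = j \<or> y' = j + 1"
    "k \<in> corners_at Q x y"
  shows "k \<in> corners_at Q x y'"
proof (rule ccontr)
  obtain a b where k: "k = (a, b)" "hor Q a b" "ver Q a b" "a \<le> x" "x \<le> a + 1" "b \<le> y" "y \<le> b + 1"
    using assms(5) by (auto simp: corners_at_def)
  assume "k \<notin> corners_at Q x y'"
  then have "b \<noteq> j"
    using k assms(4) by (auto simp: corners_at_def)
  then have b: "b = j - 1 \<or> b = j + 1" using k(6,7) assms(3) by linarith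
  have a: "\<bar>a - i\<bar> \<le> 1" using assms(2) k by linarith
  have "\<not> ver Q i j"
    using corner_cells_disjoint[of a b i j] k(2,3) assms(1) a b by auto
  then have "hor Q a j" "ver Q a j"
    using cell_above_or_below[OF assms(1) _ a b] k(2) by (auto simp: hor_def)
  then show False
    using corner_cells_disjoint[of a b a j] k(2,3) b by auto
qed

lemma corners_at_opposite:
  assumes "hor Q i j" "x = i \<or> x = i + 1"
  shows "corners_at Q x (j + 1) = corners_at Q x j"
  using corners_at_mem_opposite[OF assms, of j "j + 1"] corners_at_mem_opposite[OF assms, of "j + 1" j]
  by blast

lemma no_cell_beyond:
  assumes "hor Q i j" "x = i \<or> x = i + 1" "corners_at Q x j = {}"
    "k \<le> x" "x \<le> k + 1" "l = j - 1 \<or> l = j + 1"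
  shows "\<not> Q k l"
proof
  assume "Q k l"
  have "(i, j) \<notin> corners_at Q x j" "(k, j) \<notin> corners_at Q x j" using assms(3) by auto
  then show False
    using cell_above_or_below[OF assms(1) \<open>Q k l\<close> _ assms(6)] assms by (auto simp: corners_at_def)
qed

text \<open>
  At a vertex of a horizontal run that belongs to no corner cell, the vertical track consists of a
  single rung.
\<close>

lemma rung_if_no_corner:
  assumes "hor Q i j" "int x = i \<or> int x = i + 1" "int y = j \<or> int y = j + 1"
    "corners_at Q (int x) (int y) = {}" "track (transposed Q) (int x) y = track (transposed Q) (int x) y'"
  shows "int y' = j \<or> int y' = j + 1"
proof (rule ccontr)
  assume y': "\<not> ?thesis"
  have no: "corners_at Q (int x) j = {}"
    using assms(3,4) corners_at_opposite[OF assms(1,2)] by auto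
  have no_edge: "\<not> hedge (transposed Q) l (int x)" if "l = j - 1 \<or> l = j + 1" for l
    using no_cell_beyond[OF assms(1,2) no, of _ l] that by (auto simp: hedge_def transposed_def)
  show False
  proof (cases "int y' > j + 1")
    case True
    then have "hedge (transposed Q) (int (nat (j + 1))) (int x)"
      using assms(3) by (intro hedge_if_track_eq[OF assms(5)]) auto
    then show False using no_edge[of "j + 1"] assms(3) by auto
  next
    case False
    then have "int y' \<le> j - 1" using y' by linarith
    then have "hedge (transposed Q) (int (nat (j - 1))) (int x)"
      using assms(3) by (intro hedge_if_track_eq[OF assms(5)[symmetric]]) auto
    then show False using no_edge[of "j - 1"] \<open>int y' \<le> j - 1\<close> by auto
  qed
qed

end

section \<open>Inner intervals and the shape of thin cycles\<close>

text \<open>Membership of the cell with lower left corner \<open>(x, y)\<close>.\<close>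

definition has_cell :: "point set set \<Rightarrow> int \<Rightarrow> int \<Rightarrow> bool" where
  "has_cell P x y \<longleftrightarrow> 0 \<le> x \<and> 0 \<le> y \<and> cell (nat x, nat y) \<in> P"

lemma in_cell_iff:
  "v \<in> cell a \<longleftrightarrow> fst a \<le> fst v \<and> fst v \<le> fst a + 1 \<and> snd a \<le> snd v \<and> snd v \<le> snd a + 1"
  by (auto simp: cell_def less_eq_prod_def)

lemma cell_subset_iff: "cell a \<subseteq> {c..d} \<longleftrightarrow> c \<le> a \<and> a + (1, 1) \<le> d"
  by (auto simp: cell_def less_eq_prod_def)

lemma cell_eq_iff: "cell a = cell b \<longleftrightarrow> a = b"
  by (auto simp: cell_def prod_eq_iff less_eq_prod_def)

lemma inner_interval_iff:
  "inner_interval P a b \<longleftrightarrow> fst a < fst b \<and> snd a < snd b \<and>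
     (\<forall>i j. int (fst a) \<le> i \<and> i < int (fst b) \<and> int (snd a) \<le> j \<and> j < int (snd b) \<longrightarrow> has_cell P i j)"
proof -
  have "cells_in a b \<subseteq> P \<longleftrightarrow> (\<forall>c. a \<le> c \<and> c + (1, 1) \<le> b \<longrightarrow> cell c \<in> P)"
    unfolding cells_in_def by (simp only: cell_subset_iff[symmetric]) blast
  also have "\<dots> \<longleftrightarrow> (\<forall>i j. int (fst a) \<le> i \<and> i < int (fst b) \<and> int (snd a) \<le> j \<and> j < int (snd b) \<longrightarrow>
      has_cell P i j)" (is "?L \<longleftrightarrow> ?R")
  proof
    assume ?L
    then have "cell (nat i, nat j) \<in> P"
      if "int (fst a) \<le> i" "i < int (fst b)" "int (snd a) \<le> j" "j < int (snd b)" for i j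
      using that by (auto simp: less_eq_prod_def simp del: split_paired_All dest: spec[of _ "(nat i, nat j)"])
    then show ?R by (auto simp: has_cell_def)
  next
    assume R: ?R
    show ?L
    proof (intro allI impI)
      fix c assume "a \<le> c \<and> c + (1, 1) \<le> b"
      then have "has_cell P (int (fst c)) (int (snd c))"
        using R by (auto simp: less_eq_prod_def)
      then show "cell c \<in> P" by (simp add: has_cell_def)
    qed
  qed
  finally show ?thesis by (simp add: inner_interval_def)
qed

lemma interval_length_eq: "interval_length a b = (fst b - fst a) * (snd b - snd a)"
proof -
  have "cells_in a b = cell ` ({fst a..<fst b} \<times> {snd a..<snd b})"
    by (fastforce simp: cells_in_def cell_subset_iff less_eq_prod_def image_iff)
  then show ?thesis
    by (simp add: interval_length_def card_image inj_on_def cell_eq_iff card_cartesian_product)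
qed

text \<open>
  A box of at most two cells is too short to be a maximal inner interval, so it can be enlarged on
  one of its four sides.
\<close>

lemma small_box_extends:
  assumes max: "\<forall>a b. maximal_inner_interval P a b \<longrightarrow> interval_length a b \<ge> 3"
    and "0 < w" "0 < h" "w * h < 3"
    and box: "\<forall>i j. x \<le> i \<and> i < x + int w \<and> y \<le> j \<and> j < y + int h \<longrightarrow> has_cell P i j"
  obtains (left) "\<And>j. y \<le> j \<Longrightarrow> j < y + int h \<Longrightarrow> has_cell P (x - 1) j"
    | (right) "\<And>j. y \<le> j \<Longrightarrow> j < y + int h \<Longrightarrow> has_cell P (x + int w) j"
    | (below) "\<And>i. x \<le> i \<Longrightarrow> i < x + int w \<Longrightarrow> has_cell P i (y - 1)"
    | (above) "\<And>i. x \<le> i \<Longrightarrow> i < x + int w \<Longrightarrow> has_cell P i (y + int h)"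
proof -
  have xy: "0 \<le> x" "0 \<le> y" using spec[OF spec[OF box, of x], of y] assms(2,3) by (auto simp: has_cell_def)
  define a b where "a = (nat x, nat y)" and "b = (nat x + w, nat y + h)"
  have inner: "inner_interval P a b"
    unfolding inner_interval_iff using box assms(2,3) xy by (simp add: a_def b_def)
  have "interval_length a b < 3"
    using assms(4) by (simp add: interval_length_eq a_def b_def)
  then obtain c d where cd: "inner_interval P c d" "{a..b} \<subset> {c..d}"
    using max inner by (meson maximal_inner_interval_def not_le)
  have "a \<le> b" by (simp add: a_def b_def)
  then have le: "c \<le> a" "b \<le> d" using cd(2) by (simp_all add: psubset_eq)
  have bounds: "int (fst c) \<le> x" "x + int w \<le> int (fst d)" "int (snd c) \<le> y" "y + int h \<le> int (snd d)"
    using le xy by (auto simp: a_def b_def less_eq_prod_def)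
  have "\<not> (a = c \<and> b = d)" using cd(2) by auto
  then have ext: "int (fst c) < x \<or> int (fst d) > x + int w \<or> int (snd c) < y \<or> int (snd d) > y + int h"
    using bounds xy by (auto simp: a_def b_def prod_eq_iff)
  have cell: "has_cell P i j"
    if "int (fst c) \<le> i" "i < int (fst d)" "int (snd c) \<le> j" "j < int (snd d)" for i j
    using cd(1) that unfolding inner_interval_iff by blast
  from ext show ?thesis
  proof (elim disjE)
    assume "int (fst c) < x"
    then show ?thesis using bounds by (intro left cell) auto
  next
    assume "int (fst d) > x + int w"
    then show ?thesis using bounds by (intro right cell) auto
  next
    assume "int (snd c) < y"
    then show ?thesis using bounds by (intro below cell) auto
  next
    assume "int (snd d) > y + int h"
    then show ?thesis using bounds by (intro above cell) auto
  qed
qed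

lemma thin_no_square:
  assumes "thin P"
  shows "\<not> (has_cell P x y \<and> has_cell P (x + 1) y \<and> has_cell P x (y + 1) \<and> has_cell P (x + 1) (y + 1))"
proof
  assume *: "has_cell P x y \<and> has_cell P (x + 1) y \<and> has_cell P x (y + 1) \<and> has_cell P (x + 1) (y + 1)"
  then have "{cell (nat x, nat y), cell ((nat x, nat y) + (1, 0)), cell ((nat x, nat y) + (0, 1)),
      cell ((nat x, nat y) + (1, 1))} \<subseteq> P"
    by (auto simp: has_cell_def nat_add_distrib)
  then show False using assms unfolding thin_def by blast
qed

lemma run_extends_hor:
  assumes max: "\<forall>a b. maximal_inner_interval P a b \<longrightarrow> interval_length a b \<ge> 3" and thin: "thin P"
    and cells: "has_cell P x y" "has_cell P (x + 1) y"
  shows "has_cell P (x - 1) y \<or> has_cell P (x + 2) y"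
proof -
  have box: "\<forall>i j. x \<le> i \<and> i < x + int 2 \<and> y \<le> j \<and> j < y + int 1 \<longrightarrow> has_cell P i j"
  proof (intro allI impI)
    fix i j assume "x \<le> i \<and> i < x + int 2 \<and> y \<le> j \<and> j < y + int 1"
    then have "(i = x \<or> i = x + 1) \<and> j = y" by auto
    then show "has_cell P i j" using cells by auto
  qed
  show ?thesis
  proof (rule small_box_extends[of P 2 1 x y, OF max _ _ _ box])
    assume "\<And>j. \<lbrakk>y \<le> j; j < y + int 1\<rbrakk> \<Longrightarrow> has_cell P (x - 1) j"
    from this[of y] show ?thesis by simp
  next
    assume "\<And>j. \<lbrakk>y \<le> j; j < y + int 1\<rbrakk> \<Longrightarrow> has_cell P (x + int 2) j"
    from this[of y] show ?thesis by simp
  next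
    assume "\<And>i. \<lbrakk>x \<le> i; i < x + int 2\<rbrakk> \<Longrightarrow> has_cell P i (y - 1)"
    from this[of x] this[of "x + 1"] show ?thesis
      using thin_no_square[OF thin, of x "y - 1"] cells by simp
  next
    assume "\<And>i. \<lbrakk>x \<le> i; i < x + int 2\<rbrakk> \<Longrightarrow> has_cell P i (y + int 1)"
    from this[of x] this[of "x + 1"] show ?thesis
      using thin_no_square[OF thin, of x y] cells by simp
  qed simp_all
qed

lemma run_extends_ver:
  assumes max: "\<forall>a b. maximal_inner_interval P a b \<longrightarrow> interval_length a b \<ge> 3" and thin: "thin P"
    and cells: "has_cell P x y" "has_cell P x (y + 1)"
  shows "has_cell P x (y - 1) \<or> has_cell P x (y + 2)"
proof -
  have box: "\<forall>i j. x \<le> i \<and> i < x + int 1 \<and> y \<le> j \<and> j < y + int 2 \<longrightarrow> has_cell P i j"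
  proof (intro allI impI)
    fix i j assume "x \<le> i \<and> i < x + int 1 \<and> y \<le> j \<and> j < y + int 2"
    then have "i = x \<and> (j = y \<or> j = y + 1)" by auto
    then show "has_cell P i j" using cells by auto
  qed
  show ?thesis
  proof (rule small_box_extends[of P 1 2 x y, OF max _ _ _ box])
    assume "\<And>j. \<lbrakk>y \<le> j; j < y + int 2\<rbrakk> \<Longrightarrow> has_cell P (x - 1) j"
    from this[of y] this[of "y + 1"] show ?thesis
      using thin_no_square[OF thin, of "x - 1" y] cells by simp
  next
    assume "\<And>j. \<lbrakk>y \<le> j; j < y + int 2\<rbrakk> \<Longrightarrow> has_cell P (x + int 1) j"
    from this[of y] this[of "y + 1"] show ?thesis
      using thin_no_square[OF thin, of x y] cells by simp
  next
    assume "\<And>i. \<lbrakk>x \<le> i; i < x + int 1\<rbrakk> \<Longrightarrow> has_cell P i (y - 1)"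
    from this[of x] show ?thesis by simp
  next
    assume "\<And>i. \<lbrakk>x \<le> i; i < x + int 1\<rbrakk> \<Longrightarrow> has_cell P i (y + int 2)"
    from this[of x] show ?thesis by simp
  qed simp_all
qed

lemma cell_has_neighbour:
  assumes max: "\<forall>a b. maximal_inner_interval P a b \<longrightarrow> interval_length a b \<ge> 3"
    and cells: "has_cell P x y"
  shows "hor (has_cell P) x y \<or> ver (has_cell P) x y"
proof -
  have box: "\<forall>i j. x \<le> i \<and> i < x + int 1 \<and> y \<le> j \<and> j < y + int 1 \<longrightarrow> has_cell P i j"
  proof (intro allI impI)
    fix i j assume "x \<le> i \<and> i < x + int 1 \<and> y \<le> j \<and> j < y + int 1"
    then have "i = x \<and> j = y" by auto
    then show "has_cell P i j" using cells by auto
  qed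
  show ?thesis
  proof (rule small_box_extends[of P 1 1 x y, OF max _ _ _ box])
    assume "\<And>j. \<lbrakk>y \<le> j; j < y + int 1\<rbrakk> \<Longrightarrow> has_cell P (x - 1) j"
    from this[of y] show ?thesis using cells by (simp add: hor_def)
  next
    assume "\<And>j. \<lbrakk>y \<le> j; j < y + int 1\<rbrakk> \<Longrightarrow> has_cell P (x + int 1) j"
    from this[of y] show ?thesis using cells by (simp add: hor_def)
  next
    assume "\<And>i. \<lbrakk>x \<le> i; i < x + int 1\<rbrakk> \<Longrightarrow> has_cell P i (y - 1)"
    from this[of x] show ?thesis using cells by (simp add: ver_def)
  next
    assume "\<And>i. \<lbrakk>x \<le> i; i < x + int 1\<rbrakk> \<Longrightarrow> has_cell P i (y + int 1)"
    from this[of x] show ?thesis using cells by (simp add: ver_def)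
  qed simp_all
qed

lemma cells_meet_iff:
  "cell a \<inter> cell b \<noteq> {} \<longleftrightarrow>
     \<bar>int (fst a) - int (fst b)\<bar> \<le> 1 \<and> \<bar>int (snd a) - int (snd b)\<bar> \<le> 1"
proof
  assume "cell a \<inter> cell b \<noteq> {}"
  then show "\<bar>int (fst a) - int (fst b)\<bar> \<le> 1 \<and> \<bar>int (snd a) - int (snd b)\<bar> \<le> 1"
    by (auto simp: in_cell_iff)
next
  assume "\<bar>int (fst a) - int (fst b)\<bar> \<le> 1 \<and> \<bar>int (snd a) - int (snd b)\<bar> \<le> 1"
  then have "(max (fst a) (fst b), max (snd a) (snd b)) \<in> cell a \<inter> cell b"
    by (auto simp: in_cell_iff)
  then show "cell a \<inter> cell b \<noteq> {}" by blast
qed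

lemma adjacent_if_common_edge:
  assumes "e \<in> cell_edges a" "e \<subseteq> cell b" "a \<noteq> b"
  shows "\<bar>int (fst a) - int (fst b)\<bar> + \<bar>int (snd a) - int (snd b)\<bar> = 1"
  using assms by (auto simp: cell_edges_def in_cell_iff prod_eq_iff)

lemma edges_cell: "edges (cell a) = cell_edges a"
  by (auto simp: edges_def cell_eq_iff)

lemma cell_edge_subset: "e \<in> cell_edges a \<Longrightarrow> e \<subseteq> cell a"
  by (auto simp: cell_edges_def in_cell_iff)

lemma cyclic_dist_one_cases:
  assumes "cyclic_dist n i j = 1" "i < n" "j < n"
  shows "j = Suc i \<or> i = Suc j \<or> i = 0 \<and> Suc j = n \<or> j = 0 \<and> Suc i = n"
proof -
  have "\<bar>int i - int j\<bar> = 1 \<or> \<bar>int i - int j\<bar> = int n - 1"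
    using assms(1) by (auto simp: cyclic_dist_def min_def split: if_splits)
  then show ?thesis using assms(2,3) by linarith
qed

lemma at_most_two_cyclic_neighbours:
  assumes "cyclic_dist n i j = 1" "cyclic_dist n i k = 1" "cyclic_dist n i l = 1"
    "i < n" "j < n" "k < n" "l < n"
  shows "j = k \<or> j = l \<or> k = l"
  using cyclic_dist_one_cases[OF assms(1,4,5)] cyclic_dist_one_cases[OF assms(2,4,6)]
    cyclic_dist_one_cases[OF assms(3,4,7)] assms(4-7)
  by (elim disjE) auto

lemma cyclic_dist_two_via:
  assumes "cyclic_dist n i j = 2" "i < n" "j < n"
  obtains k where "k < n" "cyclic_dist n i k = 1" "cyclic_dist n k j = 1"
proof (cases "\<bar>int i - int j\<bar> = 2")
  case True
  then show ?thesis
    using assms by (intro that[of "Suc (min i j)"]) (auto simp: cyclic_dist_def min_def)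
next
  case False
  then have *: "\<bar>int i - int j\<bar> = int n - 2" "4 < n"
    using assms by (auto simp: cyclic_dist_def min_def split: if_splits)
  show ?thesis
  proof (cases "min i j = 0")
    case True
    then show ?thesis
      using assms(2,3) * by (intro that[of "n - 1"]) (auto simp: cyclic_dist_def min_def split: if_splits)
  next
    case False
    then show ?thesis
      using assms(2,3) * by (intro that[of 0]) (auto simp: cyclic_dist_def min_def split: if_splits)
  qed
qed

lemma adjacent_parity:
  fixes x y x' y' :: int
  assumes "\<bar>x - x'\<bar> + \<bar>y - y'\<bar> = 1"
  shows "odd (x + y) \<longleftrightarrow> even (x' + y')"
  using assms by presburger

lemma adjacent_cases:
  fixes x y x' y' :: int
  assumes "\<bar>x - x'\<bar> + \<bar>y - y'\<bar> = 1"
  shows "x' = x + 1 \<and> y' = y \<or> x' = x - 1 \<and> y' = y \<or> x' = x \<and> y' = y + 1 \<or> x' = x \<and> y' = y - 1"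
proof (cases "x' = x")
  case True
  then show ?thesis using assms by (auto simp: abs_if split: if_splits)
next
  case False
  then have "y' = y" using assms by linarith
  then show ?thesis using assms by (auto simp: abs_if split: if_splits)
qed

text \<open>
  Adjacent cells of a thin cycle have cyclic distance \<open>1\<close>: they meet, so the distance is at most \<open>2\<close>,
  and at distance \<open>2\<close> they would form with the cell between them a triangle of adjacent cells, which
  parity excludes. Hence no cell has three neighbours. Cells that meet in a vertex only have
  cyclic distance \<open>2\<close>, and the cell between them is a common neighbour.
\<close>

lemma long_runs_has_cell:
  assumes "thin_cycle P" and max: "\<forall>a b. maximal_inner_interval P a b \<longrightarrow> interval_length a b \<ge> 3"
  shows "long_runs (has_cell P)"
proof -
  have thin: "thin P" and sub: "P \<subseteq> range cell"
    using assms(1) by (simp_all add: thin_cycle_def polyomino_def)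
  obtain Cs where Cs: "set Cs = P" "cell_path P Cs" "\<exists>e. e \<in> edges (hd Cs) \<and> e \<in> edges (last Cs)"
    and far: "\<forall>i < length Cs. \<forall>j < length Cs. cyclic_dist (length Cs) i j > 2 \<longrightarrow> Cs ! i \<inter> Cs ! j = {}"
    using assms(1) unfolding thin_cycle_def by (elim conjE exE) (erule (1) that, auto)
  define n where "n = length Cs"
  have "\<forall>k<n. \<exists>a. Cs ! k = cell a"
    using Cs(1) sub nth_mem unfolding n_def by blast
  then obtain a where a: "\<And>k. k < n \<Longrightarrow> Cs ! k = cell (a k)" by metis
  define X where "X k = int (fst (a k))" for k
  define Y where "Y k = int (snd (a k))" for k
  have "distinct Cs" "Cs \<noteq> []"
    and walk: "\<And>k. Suc k < n \<Longrightarrow> Cs ! k \<inter> Cs ! Suc k \<in> edges (Cs ! k)"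
    using Cs(2) by (auto simp: cell_path_def cell_walk_def n_def)
  have inj: "a k \<noteq> a l" if "k \<noteq> l" "k < n" "l < n" for k l
    using that \<open>distinct Cs\<close> a nth_eq_iff_index_eq n_def by metis
  have cell_iff: "has_cell P x y \<longleftrightarrow> (\<exists>k<n. X k = x \<and> Y k = y)" for x y
  proof
    assume "has_cell P x y"
    then have "0 \<le> x" "0 \<le> y" "cell (nat x, nat y) \<in> set Cs" by (auto simp: has_cell_def Cs(1))
    then obtain k where "k < n" "Cs ! k = cell (nat x, nat y)" by (metis in_set_conv_nth n_def)
    then show "\<exists>k<n. X k = x \<and> Y k = y"
      using a[of k] \<open>0 \<le> x\<close> \<open>0 \<le> y\<close> by (intro exI[of _ k]) (auto simp: cell_eq_iff X_def Y_def)
  next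
    assume "\<exists>k<n. X k = x \<and> Y k = y"
    then obtain k where "k < n" "X k = x" "Y k = y" by blast
    moreover have "cell (a k) \<in> P" using Cs(1) a[OF \<open>k < n\<close>] \<open>k < n\<close> nth_mem n_def by metis
    ultimately show "has_cell P x y" by (auto simp: has_cell_def X_def Y_def)
  qed
  let ?adj = "\<lambda>k l. \<bar>X k - X l\<bar> + \<bar>Y k - Y l\<bar> = 1"
  have succ: "?adj k (Suc k)" if "Suc k < n" for k
  proof -
    have "cell (a k) \<inter> cell (a (Suc k)) \<in> cell_edges (a k)"
      using walk[OF that] a that by (simp add: edges_cell)
    then show ?thesis
      unfolding X_def Y_def using inj[of k "Suc k"] that by (intro adjacent_if_common_edge) auto
  qed
  have wrap: "?adj 0 (n - 1)" if "n \<ge> 2"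
  proof -
    have ends: "hd Cs = cell (a 0)" "last Cs = cell (a (n - 1))"
      using a[of 0] a[of "n - 1"] that \<open>Cs \<noteq> []\<close> by (simp_all add: hd_conv_nth last_conv_nth n_def)
    obtain e where "e \<in> cell_edges (a 0)" "e \<in> cell_edges (a (n - 1))"
      using Cs(3) unfolding ends edges_cell by blast
    then have "e \<in> cell_edges (a 0)" "e \<subseteq> cell (a (n - 1))"
      by (simp_all add: cell_edge_subset)
    then show ?thesis
      unfolding X_def Y_def using inj[of 0 "n - 1"] that by (intro adjacent_if_common_edge) auto
  qed
  have adj_if_dist1: "?adj k l" if "cyclic_dist n k l = 1" "k < n" "l < n" for k l
  proof -
    have "?adj 0 (n - 1)" if "n \<noteq> 1"
      using wrap that \<open>k < n\<close> by linarith
    then show ?thesis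
      using cyclic_dist_one_cases[OF that] succ[of k] succ[of l] that by (auto simp: cyclic_dist_def abs_minus_commute)
  qed
  have via: "\<exists>m<n. ?adj k m \<and> ?adj m l" if kl: "cyclic_dist n k l = 2" "k < n" "l < n" for k l
  proof -
    obtain m where "m < n" "cyclic_dist n k m = 1" "cyclic_dist n m l = 1"
      using cyclic_dist_two_via[OF kl] .
    then show ?thesis using adj_if_dist1 kl(2,3) by blast
  qed
  have near: "cyclic_dist n k l = 1 \<or> cyclic_dist n k l = 2"
    if "k \<noteq> l" "k < n" "l < n" "\<bar>X k - X l\<bar> \<le> 1" "\<bar>Y k - Y l\<bar> \<le> 1" for k l
  proof -
    have "Cs ! k \<inter> Cs ! l \<noteq> {}"
      using that a cells_meet_iff by (simp add: X_def Y_def)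
    then have "cyclic_dist n k l \<le> 2"
      using far that(2,3) n_def by (metis not_le)
    moreover have "cyclic_dist n k l > 0"
      using that(1-3) by (auto simp: cyclic_dist_def)
    ultimately show ?thesis by linarith
  qed
  have dist1_if_adj: "cyclic_dist n k l = 1" if kl: "?adj k l" "k < n" "l < n" for k l
  proof (rule ccontr)
    assume "cyclic_dist n k l \<noteq> 1"
    moreover have "k \<noteq> l" "\<bar>X k - X l\<bar> \<le> 1" "\<bar>Y k - Y l\<bar> \<le> 1" using kl(1) by auto
    ultimately have "cyclic_dist n k l = 2"
      using near kl(2,3) by blast
    then obtain m where "?adj k m" "?adj m l"
      using via kl(2,3) by blast
    then show False
      using adjacent_parity[OF kl(1)] adjacent_parity[of "X k" "X m" "Y k" "Y m"]
        adjacent_parity[of "X m" "X l" "Y m" "Y l"] by blast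
  qed
  have two: False
    if h: "has_cell P x y" "has_cell P x1 y1" "has_cell P x2 y2" "has_cell P x3 y3"
      "\<bar>x - x1\<bar> + \<bar>y - y1\<bar> = 1" "\<bar>x - x2\<bar> + \<bar>y - y2\<bar> = 1" "\<bar>x - x3\<bar> + \<bar>y - y3\<bar> = 1"
      "(x1, y1) \<noteq> (x2, y2)" "(x1, y1) \<noteq> (x3, y3)" "(x2, y2) \<noteq> (x3, y3)"
    for x y x1 y1 x2 y2 x3 y3
  proof -
    obtain k k1 k2 k3 where k: "k < n" "X k = x" "Y k = y" "k1 < n" "X k1 = x1" "Y k1 = y1"
      "k2 < n" "X k2 = x2" "Y k2 = y2" "k3 < n" "X k3 = x3" "Y k3 = y3"
      using h(1-4) unfolding cell_iff by blast
    then have "cyclic_dist n k k1 = 1" "cyclic_dist n k k2 = 1" "cyclic_dist n k k3 = 1"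
      using h(5-7) by (auto intro!: dist1_if_adj)
    then have "k1 = k2 \<or> k1 = k3 \<or> k2 = k3"
      using at_most_two_cyclic_neighbours k by blast
    then show False using k h(8-10) by auto
  qed
  have diag: "\<exists>x'' y''. has_cell P x'' y'' \<and> \<bar>x - x''\<bar> + \<bar>y - y''\<bar> = 1 \<and> \<bar>x'' - x'\<bar> + \<bar>y'' - y'\<bar> = 1"
    if h: "has_cell P x y" "has_cell P x' y'" "\<bar>x - x'\<bar> = 1" "\<bar>y - y'\<bar> = 1" for x y x' y'
  proof -
    obtain k l where k: "k < n" "X k = x" "Y k = y" "l < n" "X l = x'" "Y l = y'"
      using h(1,2) unfolding cell_iff by blast
    have "cyclic_dist n k l \<noteq> 1"
      using adj_if_dist1[of k l] k h(3,4) by auto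
    moreover have "k \<noteq> l" using k h(3) by auto
    ultimately have "cyclic_dist n k l = 2"
      using near[of k l] k h(3,4) by auto
    then obtain m where "m < n" "?adj k m" "?adj m l" using via k(1,4) by blast
    then show ?thesis using k cell_iff by (intro exI[of _ "X m"] exI[of _ "Y m"]) auto
  qed
  show ?thesis
  proof
    fix x y
    show "\<not> has_cell P x (y - 1) \<and> \<not> has_cell P x (y + 1)"
      if "has_cell P x y" "has_cell P (x - 1) y" "has_cell P (x + 1) y"
      using two[OF that, of x "y - 1"] two[OF that, of x "y + 1"] by auto
    show "\<not> has_cell P (x - 1) y \<and> \<not> has_cell P (x + 1) y"
      if "has_cell P x y" "has_cell P x (y - 1)" "has_cell P x (y + 1)"
      using two[OF that, of "x - 1" y] two[OF that, of "x + 1" y] by auto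
    show "has_cell P (x + 1) y \<or> has_cell P x (y + 1)"
      if cells: "has_cell P x y" "has_cell P (x + 1) (y + 1)"
    proof -
      obtain p q where pq: "has_cell P p q" "\<bar>x - p\<bar> + \<bar>y - q\<bar> = 1" "\<bar>p - (x + 1)\<bar> + \<bar>q - (y + 1)\<bar> = 1"
        using diag[OF cells] by auto
      then have "p = x + 1 \<and> q = y \<or> p = x \<and> q = y + 1"
        using adjacent_cases[OF pq(2)] by (elim disjE) simp_all
      then show ?thesis using pq(1) by blast
    qed
    show "has_cell P x y \<or> has_cell P (x + 1) (y + 1)"
      if cells: "has_cell P (x + 1) y" "has_cell P x (y + 1)"
    proof -
      obtain p q where pq: "has_cell P p q" "\<bar>x + 1 - p\<bar> + \<bar>y - q\<bar> = 1" "\<bar>p - x\<bar> + \<bar>q - (y + 1)\<bar> = 1"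
        using diag[OF cells] by auto
      then have "p = x \<and> q = y \<or> p = x + 1 \<and> q = y + 1"
        using adjacent_cases[OF pq(2)] by (elim disjE) simp_all
      then show ?thesis using pq(1) by blast
    qed
  qed (use run_extends_hor[OF max thin] run_extends_ver[OF max thin] cell_has_neighbour[OF max] in blast)+
qed

section \<open>The toric parametrisation of a thin cycle\<close>

text \<open>
  The target variables are of three kinds, numbered \<open>0\<close>, \<open>1\<close>, \<open>2\<close>: one for every horizontal track, one for
  every vertical track, both named by their first point, and one for every corner cell. A vertex is
  sent to the product of the variables of its two tracks and of the corner cell that contains it,
  if there is one.
\<close>

definition track_weight :: "nat \<Rightarrow> (int \<Rightarrow> int \<Rightarrow> bool) \<Rightarrow> nat \<Rightarrow> nat \<Rightarrow> nat \<Rightarrow>\<^sub>0 nat" where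
  "track_weight k Q x y = Poly_Mapping.single (to_nat (k, int (track Q (int y) x), int y)) 1"

definition corner_weight :: "(int \<Rightarrow> int \<Rightarrow> bool) \<Rightarrow> nat \<Rightarrow> nat \<Rightarrow> nat \<Rightarrow>\<^sub>0 nat" where
  "corner_weight Q x y =
     (\<Sum>c\<in>corners_at Q (int x) (int y). Poly_Mapping.single (to_nat (2::nat, c)) 1)"

definition vertex_weight :: "(int \<Rightarrow> int \<Rightarrow> bool) \<Rightarrow> point \<Rightarrow> nat \<Rightarrow>\<^sub>0 nat" where
  "vertex_weight Q v =
     track_weight 0 Q (fst v) (snd v) + track_weight 1 (transposed Q) (snd v) (fst v) +
     corner_weight Q (fst v) (snd v)"

lemma lookup_track_weight:
  "Poly_Mapping.lookup (track_weight k Q x y) (to_nat (l, a, b)) =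
     (if k = l \<and> int (track Q (int y) x) = a \<and> int y = b then 1 else 0)"
  by (auto simp: track_weight_def lookup_single when_def)

lemma lookup_corner_weight:
  fixes l :: nat
  shows "Poly_Mapping.lookup (corner_weight Q x y) (to_nat (l, c)) =
     (if l = 2 \<and> c \<in> corners_at Q (int x) (int y) then 1 else 0)"
proof -
  have "Poly_Mapping.lookup (corner_weight Q x y) (to_nat (l, c)) =
      (\<Sum>d\<in>corners_at Q (int x) (int y). if d = c then if l = 2 then 1 else 0 else 0)"
    unfolding corner_weight_def lookup_sum
    by (intro sum.cong) (auto simp: lookup_single when_def)
  then show ?thesis
    using finite_corners_at[of Q "int x" "int y"] by simp
qed

lemma vertex_weight_hor_pos_iff:
  "Poly_Mapping.lookup (vertex_weight Q v) (to_nat (0::nat, int t, int y)) > 0 \<longleftrightarrow>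
     snd v = y \<and> track Q (int y) (fst v) = t"
  by (auto simp: vertex_weight_def lookup_add lookup_track_weight lookup_corner_weight)

lemma vertex_weight_ver_pos_iff:
  "Poly_Mapping.lookup (vertex_weight Q v) (to_nat (1::nat, int t, int x)) > 0 \<longleftrightarrow>
     fst v = x \<and> track (transposed Q) (int x) (snd v) = t"
  by (auto simp: vertex_weight_def lookup_add lookup_track_weight lookup_corner_weight)

lemma vertex_weight_corner_pos_iff:
  "Poly_Mapping.lookup (vertex_weight Q v) (to_nat (2::nat, c)) > 0 \<longleftrightarrow>
     c \<in> corners_at Q (int (fst v)) (int (snd v))"
  by (cases c) (auto simp: vertex_weight_def lookup_add lookup_track_weight lookup_corner_weight)

lemma vertex_weight_nonzero: "vertex_weight Q v \<noteq> 0"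
proof
  assume "vertex_weight Q v = 0"
  then show False
    using vertex_weight_hor_pos_iff[of Q v "track Q (int (snd v)) (fst v)" "snd v"] by simp
qed

lemma transposed_transposed [simp]: "transposed (transposed Q) = Q"
  by (simp add: transposed_def fun_eq_iff)

lemma inner_interval_corners:
  assumes "inner_interval P (x, y) (x', y')"
  shows "(x, y) \<in> vertices P" "(x', y') \<in> vertices P" "(x, y') \<in> vertices P" "(x', y) \<in> vertices P"
proof -
  have lt: "x < x'" "y < y'" using assms by (auto simp: inner_interval_def)
  have "(i, j) \<in> vertices P" if "x \<le> k" "k < x'" "y \<le> l" "l < y'" "k \<le> i" "i \<le> Suc k" "l \<le> j" "j \<le> Suc l"
    for i j k l
  proof -
    have "has_cell P (int k) (int l)" using assms that unfolding inner_interval_iff by simp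
    then have "cell (k, l) \<in> P" by (simp add: has_cell_def)
    moreover have "(i, j) \<in> cell (k, l)" using that by (simp add: in_cell_iff)
    ultimately show ?thesis unfolding vertices_def by blast
  qed
  from this[of x y x y] this[of "x' - 1" "y' - 1" x' y'] this[of x "y' - 1" x y'] this[of "x' - 1" y x' y]
  show "(x, y) \<in> vertices P" "(x', y') \<in> vertices P" "(x, y') \<in> vertices P" "(x', y) \<in> vertices P"
    using lt by auto
qed

lemma inner_2_minors_in_carrier: "inner_2_minors P \<subseteq> carrier (poly_ring_on (vertices P))"
proof
  fix p :: "(point \<Rightarrow>\<^sub>0 nat) \<Rightarrow>\<^sub>0 'k::field" assume "p \<in> inner_2_minors P"
  then obtain a b where p: "p = var a * var b - var (fst a, snd b) * var (fst b, snd a)"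
    and ab: "inner_interval P a b"
    by (auto simp: inner_2_minors_def)
  have var: "(var v :: (point \<Rightarrow>\<^sub>0 nat) \<Rightarrow>\<^sub>0 'k) \<in> carrier (poly_ring_on (vertices P))" if "v \<in> vertices P" for v
    unfolding var_def using that by (intro monom_in_carrier) simp
  show "p \<in> carrier (poly_ring_on (vertices P))"
    unfolding p using inner_interval_corners[of P "fst a" "snd a" "fst b" "snd b"] ab
    by (intro diff_in_carrier mult_in_carrier var) simp_all
qed

lemma corner_weight_eq:
  assumes "corners_at Q (int x) (int y) = corners_at Q (int x') (int y')"
  shows "corner_weight Q x y = corner_weight Q x' y'"
  using assms by (simp add: corner_weight_def)

context long_runs
begin

text \<open>
  The set contains no square of four cells, so a rectangle of cells is a single row or column; its
  outer cells lie in a run of that direction.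
\<close>

lemma row_or_column:
  assumes "x < x'" "y < y'" "\<forall>i j. int x \<le> i \<and> i < int x' \<and> int y \<le> j \<and> j < int y' \<longrightarrow> Q i j"
  shows "y' = Suc y \<and> hor Q (int x) (int y) \<and> hor Q (int x' - 1) (int y) \<or>
    x' = Suc x \<and> ver Q (int x) (int y) \<and> ver Q (int x) (int y' - 1)"
proof -
  have cell: "Q i j" if "int x \<le> i" "i < int x'" "int y \<le> j" "j < int y'" for i j
    using assms(3) that by blast
  consider "x' = Suc x" "y' = Suc y" | "Suc x < x'" "y' = Suc y" | "x' = Suc x" "Suc y < y'"
    | "Suc x < x'" "Suc y < y'"
    using assms(1,2) by linarith
  then show ?thesis
  proof cases
    case 1
    then show ?thesis using not_isolated[of "int x" "int y"] cell[of "int x" "int y"] by simp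
  next
    case 2
    then show ?thesis
      using cell[of "int x" "int y"] cell[of "int x + 1" "int y"] cell[of "int x' - 1" "int y"]
        cell[of "int x' - 2" "int y"] by (simp add: hor_def)
  next
    case 3
    then show ?thesis
      using cell[of "int x" "int y"] cell[of "int x" "int y + 1"] cell[of "int x" "int y' - 1"]
        cell[of "int x" "int y' - 2"] by (simp add: ver_def)
  next
    case 4
    then show ?thesis
      using cell[of "int x" "int y"] cell[of "int x + 1" "int y"] cell[of "int x" "int y + 1"]
        cell[of "int x + 1" "int y + 1"] no_square[of "int x" "int y"] by simp
  qed
qed

lemma corners_at_opposite_ver:
  assumes "ver Q i j" "y = j \<or> y = j + 1"
  shows "corners_at Q (i + 1) y = corners_at Q i y"
proof -
  interpret T: long_runs "transposed Q" by (rule long_runs_transposed)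
  have "corners_at (transposed Q) y (i + 1) = corners_at (transposed Q) y i"
    using T.corners_at_opposite[of j i y] assms by (simp add: hor_transposed)
  then show ?thesis
    by (simp add: corners_at_transposed inj_image_eq_iff)
qed

text \<open>
  The horizontal and vertical tracks of the diagonal corners of an inner interval are those of its
  anti-diagonal corners. For the corner cells this holds since the interval is a row or column and
  the ends of a rung lie in the same corner cells.
\<close>

lemma vertex_weight_minor:
  assumes lt: "x < x'" "y < y'"
    and cells: "\<forall>i j. int x \<le> i \<and> i < int x' \<and> int y \<le> j \<and> j < int y' \<longrightarrow> Q i j"
  shows "vertex_weight Q (x, y) + vertex_weight Q (x', y') =
    vertex_weight Q (x, y') + vertex_weight Q (x', y)"
proof -
  have hor: "track_weight 0 Q x y = track_weight 0 Q x' y" "track_weight 0 Q x y' = track_weight 0 Q x' y'"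
    unfolding track_weight_def using lt cells
    by (auto intro!: arg_cong2[where f = Poly_Mapping.single] track_eqI simp: hedge_def)
  have ver: "track_weight 1 (transposed Q) y x = track_weight 1 (transposed Q) y' x"
      "track_weight 1 (transposed Q) y x' = track_weight 1 (transposed Q) y' x'"
    unfolding track_weight_def using lt cells
    by (auto intro!: arg_cong2[where f = Poly_Mapping.single] track_eqI simp: hedge_def transposed_def)
  have "corner_weight Q x y = corner_weight Q x y' \<and> corner_weight Q x' y = corner_weight Q x' y' \<or>
      corner_weight Q x y = corner_weight Q x' y \<and> corner_weight Q x y' = corner_weight Q x' y'"
    using row_or_column[OF assms]
  proof
    assume *: "y' = Suc y \<and> hor Q (int x) (int y) \<and> hor Q (int x' - 1) (int y)"
    then show ?thesis
      using corners_at_opposite[of "int x" "int y" "int x"] corners_at_opposite[of "int x' - 1" "int y" "int x'"]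
      by (intro disjI1 conjI corner_weight_eq) (simp_all add: add.commute)
  next
    assume *: "x' = Suc x \<and> ver Q (int x) (int y) \<and> ver Q (int x) (int y' - 1)"
    then show ?thesis
      using corners_at_opposite_ver[of "int x" "int y" "int y"] corners_at_opposite_ver[of "int x" "int y' - 1" "int y'"]
      by (intro disjI2 conjI corner_weight_eq) (simp_all add: add.commute)
  qed
  then show ?thesis
    using hor ver by (auto simp: vertex_weight_def algebra_simps)
qed

end

lemma toric_map_polyomino_ideal:
  assumes "long_runs (has_cell P)" "p \<in> polyomino_ideal P"
  shows "toric_map (vertex_weight (has_cell P)) p = 0"
proof (rule toric_map_genideal[OF inner_2_minors_in_carrier])
  show "p \<in> genideal (poly_ring_on (vertices P)) (inner_2_minors P)"
    using assms(2) by (simp add: polyomino_ideal_def polyomino_ring_def)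
next
  fix s :: "(point \<Rightarrow>\<^sub>0 nat) \<Rightarrow>\<^sub>0 'a" assume "s \<in> inner_2_minors P"
  then obtain x y x' y' where s: "s = var (x, y) * var (x', y') - var (x, y') * var (x', y)"
    and "inner_interval P (x, y) (x', y')"
    by (auto simp: inner_2_minors_def)
  then have "vertex_weight (has_cell P) (x, y) + vertex_weight (has_cell P) (x', y') =
      vertex_weight (has_cell P) (x, y') + vertex_weight (has_cell P) (x', y)"
    using long_runs.vertex_weight_minor[OF assms(1)] unfolding inner_interval_iff by simp
  then show "toric_map (vertex_weight (has_cell P)) s = 0"
    unfolding s by (simp add: toric_map_diff var_def mult_single weight_add weight_single[unfolded One_nat_def])
qed

text \<open>The parameter \<open>I\<close> only serves to fix the field of coefficients.\<close>

locale long_run_polyomino =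
  fixes P :: "point set set" and I :: "((point \<Rightarrow>\<^sub>0 nat) \<Rightarrow>\<^sub>0 'k::field) set"
  assumes long_runs: "long_runs (has_cell P)" and cells: "P \<subseteq> range cell"
    and I: "I = polyomino_ideal P"
begin

interpretation long_runs "has_cell P" by (rule long_runs)

interpretation T: long_runs "transposed (has_cell P)" by (rule long_runs_transposed)

lemma ideal: "ideal I (poly_ring_on (vertices P))"
  unfolding I polyomino_ideal_def polyomino_ring_def
  by (intro ring.genideal_ideal cring.axioms(1) cring_poly_ring_on inner_2_minors_in_carrier)

interpretation poly_ideal "vertices P" I by (rule poly_ideal.intro) (rule ideal)

lemma minor_mem:
  assumes "inner_interval P (x, y) (x', y')"
  shows "var (x, y) * var (x', y') - var (x, y') * var (x', y) \<in> I"
proof -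
  have "(var (x, y) * var (x', y') - var (x, y') * var (x', y) :: _ \<Rightarrow>\<^sub>0 'k) \<in> inner_2_minors P"
    unfolding inner_2_minors_def using assms by fastforce
  then show ?thesis
    unfolding I polyomino_ideal_def polyomino_ring_def
    using ring.genideal_self[OF cring.axioms(1)[OF cring_poly_ring_on] inner_2_minors_in_carrier] by blast
qed

lemma exchange_in_interval:
  assumes m: "Poly_Mapping.keys m \<subseteq> vertices P" "(x, y') \<in> Poly_Mapping.keys m" "(x', y) \<in> Poly_Mapping.keys m"
    and ne: "x \<noteq> x'" "y \<noteq> y'"
    and inner: "inner_interval P (min x x', min y y') (max x x', max y y')"
  shows "\<exists>m'. Poly_Mapping.keys m' \<subseteq> vertices P \<and> (x, y) \<in> Poly_Mapping.keys m' \<and> cong m m'"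
proof (rule cong_exchange[OF m])
  show "(x, y) \<in> vertices P" "(x', y') \<in> vertices P"
    using inner_interval_corners[OF inner] by (auto simp: min_def max_def split: if_splits)
  show "var (x, y') * var (x', y) - var (x, y) * var (x', y') \<in> I"
    using minor_mem[OF inner] uminus_mem[OF minor_mem[OF inner]] ne
    by (auto simp: min_def max_def mult.commute split: if_splits)
qed (use ne in auto)

text \<open>
  If a monomial involves a vertex of a rung of a horizontal run and a vertex of a track of this run,
  then it is congruent to a monomial involving the vertex where the rung meets the track: the two
  vertices are opposite corners of an inner interval whose two other corners include that one.
\<close>

lemma hor_exchange:
  assumes cell: "hor (has_cell P) i j" "int x = i \<or> int x = i + 1" "int y = j \<or> int y = j + 1" "int y' = j \<or> int y' = j + 1"
    and m: "Poly_Mapping.keys m \<subseteq> vertices P" "(x, y') \<in> Poly_Mapping.keys m" "(x', y) \<in> Poly_Mapping.keys m"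
    and track: "track (has_cell P) (int y) x = track (has_cell P) (int y) x'"
  shows "\<exists>m'. Poly_Mapping.keys m' \<subseteq> vertices P \<and> (x, y) \<in> Poly_Mapping.keys m' \<and> cong m m'"
proof (cases "x = x' \<or> y = y'")
  case True
  then show ?thesis using m cong_refl by blast
next
  case False
  have "has_cell P k l" if "int (min x x') \<le> k" "k < int (max x x')" "int (min y y') \<le> l" "l < int (max y y')" for k l
  proof -
    have "l = j" using that(3,4) cell(3,4) by linarith
    moreover have "has_cell P (int (nat k)) j"
      using that(1,2) by (intro cells_between_if_track_eq[OF cell(1-3) track]) auto
    ultimately show ?thesis using that(1) by simp
  qed
  then have "inner_interval P (min x x', min y y') (max x x', max y y')"
    unfolding inner_interval_iff using False by auto
  then show ?thesis using exchange_in_interval[OF m] False by blast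
qed

lemma ver_exchange:
  assumes cell: "ver (has_cell P) i j" "int x = i \<or> int x = i + 1" "int y = j \<or> int y = j + 1" "int x' = i \<or> int x' = i + 1"
    and m: "Poly_Mapping.keys m \<subseteq> vertices P" "(x, y') \<in> Poly_Mapping.keys m" "(x', y) \<in> Poly_Mapping.keys m"
    and track: "track (transposed (has_cell P)) (int x) y = track (transposed (has_cell P)) (int x) y'"
  shows "\<exists>m'. Poly_Mapping.keys m' \<subseteq> vertices P \<and> (x, y) \<in> Poly_Mapping.keys m' \<and> cong m m'"
proof (cases "x = x' \<or> y = y'")
  case True
  then show ?thesis using m cong_refl by blast
next
  case False
  have "has_cell P k l" if "int (min x x') \<le> k" "k < int (max x x')" "int (min y y') \<le> l" "l < int (max y y')" for k l
  proof -
    have "k = i" using that(1,2) cell(2,4) by linarith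
    moreover have "transposed (has_cell P) (int (nat l)) i"
      using that(3,4) cell(1) by (intro T.cells_between_if_track_eq[OF _ cell(3,2) track]) (auto simp: hor_transposed)
    ultimately show ?thesis using that(3) by (simp add: transposed_def)
  qed
  then have "inner_interval P (min x x', min y y') (max x x', max y y')"
    unfolding inner_interval_iff using False by auto
  then show ?thesis using exchange_in_interval[OF m] False by blast
qed

text \<open>
  A vertex \<open>v\<close> of one of two monomials of equal weight can be moved into the other one, \<open>m\<close>. Outside
  the corner cells, one of the two tracks through \<open>v\<close> is a rung, and \<open>m\<close> involves vertices of both
  tracks; one exchange suffices. In a corner cell, \<open>m\<close> involves some vertex of this cell and vertices
  of both tracks through \<open>v\<close>; an exchange along the horizontal run brings it into the row of
  \<open>v\<close>, and an exchange along the vertical run then brings it to \<open>v\<close>.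
\<close>

lemma exchange:
  assumes m: "Poly_Mapping.keys m \<subseteq> vertices P" and n: "Poly_Mapping.keys n \<subseteq> vertices P"
    and weight: "weight (vertex_weight (has_cell P)) m = weight (vertex_weight (has_cell P)) n"
    and v: "v \<in> Poly_Mapping.keys n"
  shows "\<exists>m'. Poly_Mapping.keys m' \<subseteq> vertices P \<and> v \<in> Poly_Mapping.keys m' \<and> cong m m'"
proof -
  let ?Q = "has_cell P" and ?T = "transposed (has_cell P)"
  obtain x y where xy: "v = (x, y)" by (cases v)
  have pos: "\<exists>u\<in>Poly_Mapping.keys k. Poly_Mapping.lookup (vertex_weight ?Q u) t > 0"
    if "Poly_Mapping.lookup (vertex_weight ?Q v) t > 0"
      "weight (vertex_weight ?Q) k = weight (vertex_weight ?Q) n" for k t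
    using that v lookup_weight_pos_iff by metis
  have hor_witness: "\<exists>x'. (x', y) \<in> Poly_Mapping.keys k \<and> track ?Q (int y) x = track ?Q (int y) x'"
    if "weight (vertex_weight ?Q) k = weight (vertex_weight ?Q) n" for k
    using pos[OF _ that, of "to_nat (0::nat, int (track ?Q (int y) x), int y)"] xy
    unfolding vertex_weight_hor_pos_iff by force
  have ver_witness: "\<exists>y'. (x, y') \<in> Poly_Mapping.keys k \<and> track ?T (int x) y = track ?T (int x) y'"
    if "weight (vertex_weight ?Q) k = weight (vertex_weight ?Q) n" for k
    using pos[OF _ that, of "to_nat (1::nat, int (track ?T (int x) y), int x)"] xy
    unfolding vertex_weight_ver_pos_iff by force
  obtain x' where x': "(x', y) \<in> Poly_Mapping.keys m" "track ?Q (int y) x = track ?Q (int y) x'"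
    using hor_witness[OF weight] by blast
  obtain y' where y': "(x, y') \<in> Poly_Mapping.keys m" "track ?T (int x) y = track ?T (int x) y'"
    using ver_witness[OF weight] by blast
  show ?thesis
  proof (cases "corners_at ?Q (int x) (int y) = {}")
    case True
    obtain a where a: "cell a \<in> P" "v \<in> cell a"
      using v n cells unfolding vertices_def by blast
    define i j where "i = int (fst a)" and "j = int (snd a)"
    then have cell: "?Q i j" "int x = i \<or> int x = i + 1" "int y = j \<or> int y = j + 1"
      using a by (auto simp: has_cell_def in_cell_iff xy)
    from not_isolated[OF cell(1)] show ?thesis
    proof
      assume hor: "hor ?Q i j"
      then have "int y' = j \<or> int y' = j + 1"
        using rung_if_no_corner[OF hor cell(2,3) True y'(2)] by blast
      then show ?thesis
        using hor_exchange[OF hor cell(2,3) _ m y'(1) x'] xy by blast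
    next
      assume ver: "ver ?Q i j"
      then have "int x' = i \<or> int x' = i + 1"
        using T.rung_if_no_corner[of j i y x x'] cell(2,3) True x'(2)
        by (simp add: hor_transposed corners_at_transposed)
      then show ?thesis
        using ver_exchange[OF ver cell(2,3) _ m y'(1) x'(1) y'(2)] xy by blast
    qed
  next
    case False
    then obtain i j where c: "(i, j) \<in> corners_at ?Q (int x) (int y)" by auto
    then have corner: "hor ?Q i j" "ver ?Q i j" and x: "int x = i \<or> int x = i + 1"
      and y: "int y = j \<or> int y = j + 1"
      by (auto simp: corners_at_def)
    obtain u where "u \<in> Poly_Mapping.keys m" "(i, j) \<in> corners_at ?Q (int (fst u)) (int (snd u))"
      using pos[OF _ weight, of "to_nat (2::nat, i, j)"] c xy unfolding vertex_weight_corner_pos_iff by auto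
    then obtain a b where ab: "(a, b) \<in> Poly_Mapping.keys m" "(i, j) \<in> corners_at ?Q (int a) (int b)"
      by (cases u) auto
    then have a: "int a = i \<or> int a = i + 1" and b: "int b = j \<or> int b = j + 1"
      by (auto simp: corners_at_def)
    have "hedge ?Q i (int y)"
      using corner(1) y by (auto simp: hedge_def hor_def)
    then have edge: "hedge ?Q (int t) (int y)" if "min a x \<le> t" "t < max a x" for t
    proof -
      have "int t = i" using that a x by linarith
      then show ?thesis using \<open>hedge ?Q i (int y)\<close> by simp
    qed
    have "track ?Q (int y) a = track ?Q (int y) x"
    proof (cases "a \<le> x")
      case True
      then show ?thesis by (intro track_eqI edge) simp_all
    next
      case False
      then have "track ?Q (int y) x = track ?Q (int y) a" by (intro track_eqI edge) simp_all
      then show ?thesis by simp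
    qed
    then obtain k where k: "Poly_Mapping.keys k \<subseteq> vertices P" "(a, y) \<in> Poly_Mapping.keys k" "cong m k"
      using hor_exchange[OF corner(1) a y b m ab(1) x'(1)] x'(2) by auto
    have "weight (vertex_weight ?Q) k = weight (vertex_weight ?Q) n"
      using weight_eq_if_cong[OF toric_map_polyomino_ideal[OF long_runs], of k m] k(3) weight cong_sym I by metis
    then obtain y'' where "(x, y'') \<in> Poly_Mapping.keys k" "track ?T (int x) y = track ?T (int x) y''"
      using ver_witness by blast
    then obtain m' where "Poly_Mapping.keys m' \<subseteq> vertices P" "(x, y) \<in> Poly_Mapping.keys m'" "cong k m'"
      using ver_exchange[OF corner(2) x y a k(1) _ k(2)] by blast
    then show ?thesis using k(3) cong_trans xy by blast
  qed
qed

lemma primeideal: "primeideal I (poly_ring_on (vertices P))"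
  using exchange toric_map_polyomino_ideal[OF long_runs] vertex_weight_nonzero
  by (intro primeideal_if_exchange[of "vertex_weight (has_cell P)"]) (auto simp: I)

end

theorem corollary3p6:
  fixes P :: "point set set"
  assumes "thin_cycle P"
    and "\<And>a b. maximal_inner_interval P a b \<Longrightarrow> interval_length a b \<ge> 3"
  shows "primeideal (polyomino_ideal P :: ((point \<Rightarrow>\<^sub>0 nat) \<Rightarrow>\<^sub>0 'k::field) set) (polyomino_ring P)"
proof -
  have "long_run_polyomino P (polyomino_ideal P :: ((point \<Rightarrow>\<^sub>0 nat) \<Rightarrow>\<^sub>0 'k) set)"
    using assms long_runs_has_cell[of P]
    by (intro long_run_polyomino.intro) (auto simp: thin_cycle_def polyomino_def)
  then show ?thesis
    unfolding polyomino_ring_def by (rule long_run_polyomino.primeideal)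
qed

end
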